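(* Let $F_2(n)$ be the power series coefficients defined by $$\sum_{n\geq 0} F_2(n) q^n=\sum_{k,n\geq 0} \frac{(q^{2n+2};q^2)_k}{(q^{2n+5};q^2)_k}\,q^{2k+n+2}.$$ Then $\sum_{n\ge 0}F_2(n)q^n\succeq 0$, i.e. $F_2(n)\geq 0$ for every nonnegative integer $n$.
   Context: Notation: $q$ is a complex number with $|q|<1$; $(a;q)_0=1$, $(a;q)_n=\prod_{j=0}^{n-1}(1-aq^j)$ (and the same with $q$ replaced by $q^2$). The double sum runs over all nonnegative integers $k,n$. A power series $\sum_{n\ge0}a_nq^n$ is written $\succeq 0$ if $a_n\ge 0$ for all $n\ge 0$. *)

theory Defs
  imports "HOL-Complex_Analysis.Complex_Analysis"
begin

definition qpoch :: "complex \<Rightarrow> complex \<Rightarrow> nat \<Rightarrow> complex" where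
  "qpoch a q n = (\<Prod>j<n. 1 - a * q ^ j)"

definition F2_term :: "complex \<Rightarrow> nat \<Rightarrow> nat \<Rightarrow> complex" where
  "F2_term q k n =
     qpoch (q ^ (2*n+2)) (q\<^sup>2) k / qpoch (q ^ (2*n+5)) (q\<^sup>2) k * q ^ (2*k+n+2)"

definition F2_gf :: "complex \<Rightarrow> complex" where
  "F2_gf q = (\<Sum>\<^sub>\<infinity>(k, n)\<in>UNIV. F2_term q k n)"

text \<open>
  The Taylor coefficients at 0. The lemmas \<open>F2_term_has_sum\<close> and \<open>F2_sums\<close> below show that,
  for every \<open>q\<close> in the open unit disc, the double series converges unconditionally and the
  power series with coefficients \<open>F2\<close> converges to its sum.
\<close>

definition F2 :: "nat \<Rightarrow> complex" where
  "F2 n = fps_nth (fps_expansion F2_gf 0) n"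

lemma norm_F2_factor_le:
  fixes q :: complex
  assumes "norm q \<le> r" "r < 1"
  shows "norm ((1 - q ^ (2*n+2) * (q\<^sup>2) ^ j) / (1 - q ^ (2*n+5) * (q\<^sup>2) ^ j))
           \<le> exp (2 * r ^ j / (1 - r))"
proof -
  have r: "0 \<le> r" using assms norm_ge_zero order_trans by blast
  have pw: "norm (q ^ m) \<le> r ^ i" if "i \<le> m" for m i
  proof -
    have "norm (q ^ m) \<le> r ^ m" using assms by (simp add: norm_power power_mono)
    also have "\<dots> \<le> r ^ i" using that r assms by (intro power_decreasing) auto
    finally show ?thesis .
  qed
  have e: "q ^ a * (q\<^sup>2) ^ j = q ^ (a + 2*j)" for a
    by (simp add: power_add power_mult)
  have num: "norm (1 - q ^ (2*n+2) * (q\<^sup>2) ^ j) \<le> 1 + r ^ j"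
    using norm_triangle_ineq4[of 1 "q ^ (2*n+2+2*j)"] pw[of j "2*n+2+2*j"] unfolding e norm_one
    by linarith
  have den: "norm (1 - q ^ (2*n+5) * (q\<^sup>2) ^ j) \<ge> 1 - r ^ Suc j"
    using norm_triangle_ineq2[of 1 "q ^ (2*n+5+2*j)"] pw[of "Suc j" "2*n+5+2*j"] unfolding e norm_one
    by linarith
  have rj: "r ^ Suc j \<le> r" "r ^ Suc j \<le> r ^ j" "0 \<le> r ^ j"
    using power_decreasing[of 1 "Suc j" r] power_decreasing[of j "Suc j" r] r assms by auto
  have "norm ((1 - q ^ (2*n+2) * (q\<^sup>2) ^ j) / (1 - q ^ (2*n+5) * (q\<^sup>2) ^ j))
          \<le> (1 + r ^ j) / (1 - r ^ Suc j)"
    unfolding norm_divide using num den rj assms by (intro frac_le) auto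
  also have "\<dots> = 1 + (r ^ j + r ^ Suc j) / (1 - r ^ Suc j)"
    using rj assms by (simp add: field_simps)
  also have "(r ^ j + r ^ Suc j) / (1 - r ^ Suc j) \<le> 2 * r ^ j / (1 - r)"
    using rj assms by (intro frac_le) auto
  also have "1 + 2 * r ^ j / (1 - r) \<le> exp (2 * r ^ j / (1 - r))"
    by (rule exp_ge_add_one_self)
  finally show ?thesis by simp
qed

lemma norm_F2_term_le:
  fixes q :: complex
  assumes "norm q \<le> r" "r < 1"
  shows "norm (F2_term q k n) \<le> exp (2 / (1 - r)\<^sup>2) * (r ^ k * r ^ n)"
proof -
  have r: "0 \<le> r" using assms norm_ge_zero order_trans by blast
  have "norm (qpoch (q ^ (2*n+2)) (q\<^sup>2) k / qpoch (q ^ (2*n+5)) (q\<^sup>2) k)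
     = (\<Prod>j<k. norm ((1 - q ^ (2*n+2) * (q\<^sup>2) ^ j) / (1 - q ^ (2*n+5) * (q\<^sup>2) ^ j)))"
    unfolding qpoch_def prod_dividef[symmetric] prod_norm ..
  also have "\<dots> \<le> (\<Prod>j<k. exp (2 * r ^ j / (1 - r)))"
    using norm_F2_factor_le[OF assms] by (intro prod_mono) auto
  also have "\<dots> = exp (2 / (1 - r) * (\<Sum>j<k. r ^ j))"
    unfolding sum_distrib_left by (subst exp_sum) (auto intro!: prod.cong)
  also have "\<dots> \<le> exp (2 / (1 - r) * (1 / (1 - r)))"
  proof -
    have "(\<Sum>j<k. r ^ j) \<le> (\<Sum>j. r ^ j)"
      using r assms by (intro sum_le_suminf summable_geometric) auto
    also have "\<dots> = 1 / (1 - r)" using r assms by (intro suminf_geometric) auto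
    finally have "2 / (1 - r) * (\<Sum>j<k. r ^ j) \<le> 2 / (1 - r) * (1 / (1 - r))"
      using assms by (intro mult_left_mono) auto
    then show ?thesis by (simp only: exp_le_cancel_iff)
  qed
  finally have 1: "norm (qpoch (q ^ (2*n+2)) (q\<^sup>2) k / qpoch (q ^ (2*n+5)) (q\<^sup>2) k)
      \<le> exp (2 / (1 - r)\<^sup>2)" by (simp add: power2_eq_square)
  have "norm (q ^ (2*k+n+2)) \<le> r ^ (2*k+n+2)"
    unfolding norm_power using assms by (intro power_mono) auto
  also have "\<dots> \<le> r ^ (k + n)"
    by (rule power_decreasing) (use r assms in linarith)+
  finally have 2: "norm (q ^ (2*k+n+2)) \<le> r ^ k * r ^ n" unfolding power_add[of r k n] .
  show ?thesis unfolding F2_term_def norm_mult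
    by (rule mult_mono[OF 1 2]) auto
qed

lemma F2_majorant_summable:
  fixes r :: real
  assumes "0 \<le> r" "r < 1"
  shows "(\<lambda>(k::nat, n::nat). C * (r ^ k * r ^ n)) summable_on UNIV"
proof -
  have hs: "((\<lambda>n::nat. r ^ n) has_sum (1 / (1 - r))) UNIV"
    using assms geometric_sums[of r] by (intro sums_nonneg_imp_has_sum) auto
  have "(\<lambda>(k::nat, n::nat). r ^ k * r ^ n) summable_on (UNIV \<times> UNIV)"
  proof (rule summable_on_SigmaI)
    show "((\<lambda>n. case (k, n) of (k, n) \<Rightarrow> r ^ k * r ^ n) has_sum (r ^ k * (1 / (1 - r)))) UNIV"
      for k using has_sum_cmult_right[OF hs] by simp
    show "(\<lambda>k::nat. r ^ k * (1 / (1 - r))) summable_on UNIV"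
      using hs by (intro summable_on_cmult_left) (auto simp: summable_on_def)
  qed (use assms in auto)
  from summable_on_cmult_right[OF this, of C] show ?thesis by (simp add: case_prod_unfold)
qed

lemma F2_term_has_sum:
  assumes "norm q < 1"
  shows "((\<lambda>(k, n). F2_term q k n) has_sum F2_gf q) UNIV"
proof -
  have "(\<lambda>p. norm (case p of (k, n) \<Rightarrow> F2_term q k n)) summable_on UNIV"
    by (rule summable_on_comparison_test[OF F2_majorant_summable[of "norm q" "exp (2 / (1 - norm q)\<^sup>2)"]])
       (use assms norm_F2_term_le[of q "norm q"] in auto)
  then show ?thesis
    unfolding F2_gf_def by (rule has_sum_infsum[OF abs_summable_summable])
qed

lemma F2_gf_holomorphic: "F2_gf holomorphic_on ball 0 r" if "0 < r" "r < 1"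
proof -
  have ul: "uniform_limit (cball 0 r) (\<lambda>X q. \<Sum>(k, n)\<in>X. F2_term q k n) F2_gf
          (finite_subsets_at_top UNIV)"
    unfolding F2_gf_def
    by (rule Weierstrass_m_test_general[OF _ F2_majorant_summable[of r "exp (2 / (1 - r)\<^sup>2)"]])
       (use that norm_F2_term_le[of _ r] in auto)
  have nz: "qpoch (q ^ (2*n+5)) (q\<^sup>2) k \<noteq> 0" if "q \<in> cball 0 r" for q k n
  proof -
    have "norm q < 1" using that \<open>r < 1\<close> by auto
    then have "norm (q ^ (2*n+5+2*j)) < 1" for j
      by (simp add: norm_power power_less_one_iff)
    then have "q ^ (2*n+5+2*j) \<noteq> 1" for j by (metis less_irrefl norm_one)
    then show ?thesis by (auto simp: qpoch_def power_add power_mult)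
  qed
  have hol: "(\<lambda>q. F2_term q k n) holomorphic_on cball 0 r" for k n
  proof -
    have "(\<lambda>q. qpoch (q ^ m) (q\<^sup>2) k) holomorphic_on cball 0 r" for m
      unfolding qpoch_def by (intro holomorphic_intros)
    then show ?thesis
      unfolding F2_term_def using nz by (intro holomorphic_on_mult holomorphic_on_divide
        holomorphic_on_power holomorphic_on_ident)
  qed
  have "(\<lambda>q. \<Sum>(k, n)\<in>X. F2_term q k n) holomorphic_on cball 0 r" for X
    unfolding case_prod_unfold by (intro holomorphic_intros hol)
  then have "\<forall>\<^sub>F X in finite_subsets_at_top UNIV.
      continuous_on (cball 0 r) (\<lambda>q. \<Sum>(k, n)\<in>X. F2_term q k n) \<and>
      (\<lambda>q. \<Sum>(k, n)\<in>X. F2_term q k n) holomorphic_on ball 0 r"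
    by (intro always_eventually allI conjI holomorphic_on_imp_continuous_on
          holomorphic_on_subset[OF _ ball_subset_cball])
  from holomorphic_uniform_limit[OF this ul] show ?thesis by auto
qed

lemma F2_sums:
  assumes "norm q < 1"
  shows "(\<lambda>n. F2 n * q ^ n) sums F2_gf q"
proof -
  obtain r where r: "norm q < r" "r < 1" using assms dense by blast
  then have "0 < r" using norm_ge_zero[of q] by linarith
  with holomorphic_power_series[OF F2_gf_holomorphic, of r q] r show ?thesis
    by (simp add: F2_def fps_expansion_def)
qed

end

theory Submission
  imports Defs
begin

text \<open>
  The double series has a closed form in terms of Gauss's theta series
  \<open>\<psi>(q) = \<Sum>\<^sub>n q\<^bsup>n(n+1)/2\<^esup>\<close>, namely
  \<open>(q + q\<^sup>2 + q\<^sup>3) \<psi>(q)\<^sup>2 / (1 - q\<^sup>2) - q (1 + q\<^sup>2) / (1 - q)\<^sup>2\<close>,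
  and in this form nonnegativity becomes a statement about lattice points in a disc.

  For fixed \<open>n\<close> the sum over \<open>k\<close> telescopes (\<open>q_telescoping_sums\<close>) and leaves a quotient of infinite
  products. Summation by parts in \<open>n\<close> then turns the double series into a single one
  (\<open>F2_gf_single_sum\<close>), whose terms split into three series that the q-binomial theorem evaluates as
  products. By Gauss's identity (\<open>gauss_psi\<close>, obtained from a finite identity of Shanks) all the
  quotients of products that remain are \<open>\<psi>(q)\<close> or its inverse up to rational functions of \<open>q\<close>,
  which gives \<open>F2_gf_closed_form\<close>.

  With \<open>T\<^sub>a = a(a+1)/2\<close>, comparison of coefficients gives (\<open>F2_eq_lattice_count\<close>) that \<open>F2 (n + 3)\<close> is
  the number of pairs \<open>(a, b)\<close> with \<open>T\<^sub>a + T\<^sub>b \<le> n + 2\<close>, plus the number of those with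
  \<open>T\<^sub>a + T\<^sub>b \<le> n\<close> and \<open>T\<^sub>a + T\<^sub>b \<equiv> n\<close> modulo 2, minus \<open>2n + 4\<close>. Since \<open>T\<^sub>a + T\<^sub>b \<le> m\<close> says that
  \<open>(a + 1/2, b + 1/2)\<close> lies in the disc of squared radius \<open>2m + 1/2\<close>, the first count is about
  \<open>\<pi>n/2\<close>, the second about half of that, and \<open>3\<pi>/4 > 2\<close>. The boundary error is of order \<open>\<surd>n\<close>;
  the inequality is proved with explicit constants for \<open>n \<ge> 143\<close> (\<open>lattice_bound_large\<close>) and by
  counting for smaller \<open>n\<close> (\<open>lattice_bound_small\<close>).
\<close>

section \<open>q-shifted factorials, the q-binomial theorem and a telescoping sum\<close>

definition qpinf :: "complex \<Rightarrow> complex \<Rightarrow> complex" where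
  "qpinf a p = (\<Prod>j. 1 - a * p ^ j)"

lemma qpoch_0 [simp]: "qpoch a p 0 = 1"
  by (simp add: qpoch_def)

lemma qpoch_Suc: "qpoch a p (Suc n) = qpoch a p n * (1 - a * p ^ n)"
  by (simp add: qpoch_def)

lemma qpoch_rec: "qpoch a p (Suc n) = (1 - a) * qpoch (a * p) p n"
  by (simp add: qpoch_def prod.lessThan_Suc_shift mult.assoc del: prod.lessThan_Suc)

lemma one_minus_power_nonzero:
  fixes a p :: complex
  assumes "norm a < 1" "norm p < 1"
  shows "1 - a * p ^ j \<noteq> 0"
proof
  assume "1 - a * p ^ j = 0"
  then have "norm (a * p ^ j) = 1" by (metis eq_iff_diff_eq_0 norm_one)
  moreover have "norm (a * p ^ j) \<le> norm a * 1"
    unfolding norm_mult norm_power using assms by (intro mult_left_mono power_le_one) auto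
  ultimately show False using assms by simp
qed

lemma one_minus_pos_power_nonzero:
  fixes q :: complex
  assumes "norm q < 1" "0 < m"
  shows "1 - q ^ m \<noteq> 0"
  using assms one_minus_power_nonzero[of q q "m - 1"] by (cases m) auto

lemma qpoch_nonzero: "norm a < 1 \<Longrightarrow> norm p < 1 \<Longrightarrow> qpoch a p n \<noteq> 0"
  by (simp add: qpoch_def one_minus_power_nonzero del: right_minus_eq)

lemma convergent_qpinf:
  fixes a p :: complex
  assumes "norm p < 1"
  shows "convergent_prod (\<lambda>j. 1 - a * p ^ j)"
proof -
  have "summable (\<lambda>j. norm (1 - a * p ^ j - 1))"
    using summable_mult[OF summable_geometric[of "norm p"], of "norm a"] assms
    by (simp add: norm_mult norm_power)
  then show ?thesis
    by (rule abs_convergent_prod_imp_convergent_prod[OF summable_imp_abs_convergent_prod])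
qed

lemma qpoch_LIMSEQ: "norm p < 1 \<Longrightarrow> qpoch a p \<longlonglongrightarrow> qpinf a p"
  using convergent_prod_LIMSEQ[OF convergent_qpinf, of p a]
  unfolding qpinf_def LIMSEQ_lessThan_iff_atMost[symmetric] qpoch_def .

lemma qpinf_nonzero: "norm a < 1 \<Longrightarrow> norm p < 1 \<Longrightarrow> qpinf a p \<noteq> 0"
  unfolding qpinf_def by (rule prodinf_nonzero[OF convergent_qpinf one_minus_power_nonzero])

lemma qpinf_rec:
  assumes "norm p < 1"
  shows "qpinf a p = (1 - a) * qpinf (a * p) p"
proof (rule LIMSEQ_unique)
  show "(\<lambda>n. qpoch a p (Suc n)) \<longlonglongrightarrow> qpinf a p"
    using qpoch_LIMSEQ[OF assms] by (rule LIMSEQ_Suc)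
  show "(\<lambda>n. qpoch a p (Suc n)) \<longlonglongrightarrow> (1 - a) * qpinf (a * p) p"
    unfolding qpoch_rec by (intro tendsto_intros qpoch_LIMSEQ assms)
qed

text \<open>
  Cauchy's argument: the recurrence of the coefficients says that the sum \<open>f\<close> satisfies
  \<open>(1 - z) f(z) = (1 - a z) f(z p)\<close>. Iteration moves the argument to \<open>0\<close>, where \<open>f\<close> is continuous
  with value \<open>1\<close>, and the accumulated factors become the two infinite products.
\<close>

theorem q_binomial:
  assumes p: "norm p < 1" and z: "norm z < 1"
  shows "(\<lambda>n. qpoch a p n / qpoch p p n * z ^ n) sums (qpinf (a * z) p / qpinf z p)"
proof -
  define c where "c n = qpoch a p n / qpoch p p n" for n
  define f where "f z = (\<Sum>n. c n * z ^ n)" for z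
  have pp: "qpoch p p n \<noteq> 0" for n by (rule qpoch_nonzero[OF p p])
  have rec: "c (Suc n) * (1 - p ^ Suc n) = c n * (1 - a * p ^ n)" for n
    using pp[of n] pp[of "Suc n"] by (simp add: c_def qpoch_Suc field_simps)
  have "convergent c"
    unfolding c_def
    by (rule convergentI[OF tendsto_divide[OF qpoch_LIMSEQ[OF p] qpoch_LIMSEQ[OF p] qpinf_nonzero[OF p p]]])
  then obtain B where B: "norm (c n) \<le> B" for n
    using convergent_imp_Bseq Bseq_def by metis
  have summ: "summable (\<lambda>n. c n * w ^ n)" if "norm w < 1" for w
  proof (rule summable_comparison_test')
    show "summable (\<lambda>n. B * norm w ^ n)" using that by (intro summable_mult summable_geometric) auto
    show "norm (c n * w ^ n) \<le> B * norm w ^ n" for n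
      unfolding norm_mult norm_power using B by (intro mult_right_mono) auto
  qed
  have fe: "(1 - w) * f w = (1 - a * w) * f (w * p)" if w: "norm w < 1" for w
  proof -
    have wp: "norm (w * p) < 1" using w p by (metis norm_mult mult_strict_mono' norm_ge_zero mult_1)
    have s: "(\<lambda>n. c n * w ^ n) sums f w" "(\<lambda>n. c n * (w * p) ^ n) sums f (w * p)"
      unfolding f_def using summ w wp by (auto intro: summable_sums)
    have 1: "(\<lambda>n. c n * w ^ n - c n * (w * p) ^ n) sums (f w - f (w * p))"
      by (intro sums_diff s)
    have "(\<lambda>n. w * (c n * w ^ n) - a * w * (c n * (w * p) ^ n)) sums (w * f w - a * w * f (w * p))"
      by (intro sums_diff sums_mult s)
    moreover have "w * (c n * w ^ n) - a * w * (c n * (w * p) ^ n)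
        = c (Suc n) * w ^ Suc n - c (Suc n) * (w * p) ^ Suc n" for n
    proof -
      have "w * (c n * w ^ n) - a * w * (c n * (w * p) ^ n) = w ^ Suc n * (c n * (1 - a * p ^ n))"
        by (simp add: algebra_simps power_mult_distrib)
      also have "\<dots> = w ^ Suc n * (c (Suc n) * (1 - p ^ Suc n))" by (simp only: rec)
      finally show ?thesis by (simp add: algebra_simps power_mult_distrib)
    qed
    ultimately have "(\<lambda>n. c (Suc n) * w ^ Suc n - c (Suc n) * (w * p) ^ Suc n)
        sums (w * f w - a * w * f (w * p))" by simp
    from sums_Suc[OF this] have "(\<lambda>n. c n * w ^ n - c n * (w * p) ^ n)
        sums (w * f w - a * w * f (w * p))" by simp
    with 1 have "f w - f (w * p) = w * f w - a * w * f (w * p)" by (rule sums_unique2)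
    then show ?thesis by (simp add: algebra_simps)
  qed
  have iter: "qpoch z p k * f z = qpoch (a * z) p k * f (z * p ^ k)" for k
  proof (induction k)
    case (Suc k)
    have "norm (z * p ^ k) \<le> norm z * 1"
      unfolding norm_mult norm_power using p by (intro mult_left_mono power_le_one) auto
    with z have "norm (z * p ^ k) < 1" by linarith
    note step = fe[OF this]
    have "qpoch z p (Suc k) * f z = (1 - z * p ^ k) * (qpoch z p k * f z)"
      by (simp only: qpoch_Suc mult_ac)
    also have "\<dots> = (1 - z * p ^ k) * (qpoch (a * z) p k * f (z * p ^ k))"
      by (simp only: Suc)
    also have "\<dots> = qpoch (a * z) p k * ((1 - z * p ^ k) * f (z * p ^ k))"
      by (simp only: mult_ac)
    also have "\<dots> = qpoch (a * z) p (Suc k) * f (z * p ^ Suc k)"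
      by (simp only: step qpoch_Suc power_Suc2 mult.assoc)
    finally show ?case .
  qed simp
  have "isCont f 0"
    unfolding f_def by (rule isCont_powser[OF summ, of "1/2"]) auto
  moreover have "(\<lambda>k. z * p ^ k) \<longlonglongrightarrow> 0"
    using tendsto_mult[OF tendsto_const LIMSEQ_power_zero[OF p], of z] by simp
  ultimately have "(\<lambda>k. f (z * p ^ k)) \<longlonglongrightarrow> f 0" by (rule isCont_tendsto_compose)
  moreover have "f 0 = 1" using powser_zero[of c] by (simp add: f_def c_def)
  ultimately have "(\<lambda>k. qpoch (a * z) p k * f (z * p ^ k)) \<longlonglongrightarrow> qpinf (a * z) p * 1"
    using qpoch_LIMSEQ[OF p] by (intro tendsto_mult) simp_all
  moreover have "(\<lambda>k. qpoch z p k * f z) \<longlonglongrightarrow> qpinf z p * f z"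
    by (intro tendsto_mult qpoch_LIMSEQ[OF p] tendsto_const)
  ultimately have "qpinf z p * f z = qpinf (a * z) p"
    unfolding iter using LIMSEQ_unique by force
  then have "f z = qpinf (a * z) p / qpinf z p"
    using qpinf_nonzero[OF z p] by (simp add: field_simps)
  with summable_sums[OF summ[OF z]] show ?thesis by (simp add: f_def c_def)
qed

text \<open>
  The terms are the differences of \<open>(1 - c) (a;p)\<^sub>k / (c;p)\<^sub>k\<close>. With \<open>p = q\<^sup>2\<close>,
  \<open>a = q\<^bsup>2n+2\<^esup>\<close> and \<open>c = q\<^bsup>2n+3\<^esup>\<close> they are, up to a factor independent of \<open>k\<close>,
  the terms of the double series.
\<close>

lemma q_telescoping_sums:
  assumes p: "norm p < 1" and c: "norm c < 1"
  shows "(\<lambda>k. (c - a) * (qpoch a p k / qpoch (c * p) p k * p ^ k))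
           sums ((1 - c) * (qpinf a p / qpinf c p - 1))"
proof -
  define u where "u k = (1 - c) * (qpoch a p k / qpoch c p k)" for k
  have "u \<longlonglongrightarrow> (1 - c) * (qpinf a p / qpinf c p)"
    unfolding u_def by (intro tendsto_intros qpoch_LIMSEQ p qpinf_nonzero c)
  from telescope_sums[OF this]
  have "(\<lambda>k. u (Suc k) - u k) sums ((1 - c) * (qpinf a p / qpinf c p) - u 0)" .
  moreover have "u (Suc k) - u k = (c - a) * (qpoch a p k / qpoch (c * p) p k * p ^ k)" for k
  proof -
    have nz: "1 - c \<noteq> 0" "1 - c * p ^ k \<noteq> 0" "qpoch c p k \<noteq> 0"
      using one_minus_power_nonzero[OF c p, of 0] one_minus_power_nonzero[OF c p] qpoch_nonzero[OF c p]
      by auto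
    have eq: "qpoch (c * p) p k = qpoch c p k * (1 - c * p ^ k) / (1 - c)"
      using nz qpoch_rec[of c p k] unfolding qpoch_Suc by (simp add: field_simps)
    show ?thesis unfolding u_def qpoch_Suc eq using nz
      by (simp add: divide_simps) (simp add: algebra_simps)
  qed
  ultimately show ?thesis by (simp add: u_def right_diff_distrib)
qed

section \<open>Gauss's product for the triangular numbers\<close>

definition triangle :: "nat \<Rightarrow> nat" where
  "triangle n = n * (n + 1) div 2"

lemma triangle_0 [simp]: "triangle 0 = 0"
  by (simp add: triangle_def)

lemma triangle_Suc [simp]: "triangle (Suc n) = triangle n + Suc n"
proof -
  have "Suc n * (Suc n + 1) = n * (n + 1) + Suc n * 2" by simp
  then show ?thesis unfolding triangle_def by (metis div_mult_self1 add.commute zero_neq_numeral)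
qed

lemma double_triangle: "2 * triangle n = n * (n + 1)"
  by (induction n) auto

lemma strict_mono_triangle: "strict_mono triangle"
  by (rule strict_monoI_Suc) simp

lemma triangle_double: "triangle (2 * n) = n * (2 * n + 1)"
  using double_triangle[of "2 * n"] by simp

text \<open>
  Written with the indicator function of the triangular numbers, so that the coefficients of the
  power series can be read off.
\<close>

definition psi :: "complex \<Rightarrow> complex" where
  "psi q = (\<Sum>n. of_bool (n \<in> range triangle) * q ^ n)"

text \<open>
  Shanks's finite form of Gauss's identity. As \<open>n\<close> grows the term \<open>s = 0\<close> on the left tends to the
  infinite product, while all other terms are of order \<open>q\<^bsup>2n\<^esup>\<close>. Passing from \<open>n\<close> to \<open>n + 1\<close> changes
  each term with \<open>s \<le> n\<close> by a difference in \<open>s\<close>, so that their total change is a boundary term. It is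
  the first of the two new powers on the right, and the new term \<open>s = n + 1\<close> is the second.
\<close>

lemma shanks_identity:
  fixes q :: complex and n :: nat
  assumes q: "norm q < 1"
  defines "P \<equiv> (\<lambda>n. qpoch (q\<^sup>2) (q\<^sup>2) n / qpoch q (q\<^sup>2) n)"
  shows "(\<Sum>s\<le>n. P n / P s * q ^ (s * (2 * n + 1))) = (\<Sum>s\<le>2 * n. q ^ triangle s)"
proof (induction n)
  case 0
  show ?case by (simp add: P_def)
next
  case (Suc n)
  note nz = one_minus_pos_power_nonzero[OF q]
  have q2: "norm (q\<^sup>2) < 1" using q by (simp add: norm_power power_less_one_iff)
  have Pnz: "P s \<noteq> 0" for s
    unfolding P_def using qpoch_nonzero[OF q q2] qpoch_nonzero[OF q2 q2] by simp
  have P_Suc: "P (Suc s) = P s * (1 - q ^ (2 * s + 2)) / (1 - q ^ (2 * s + 1))" for s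
  proof -
    have "q\<^sup>2 * (q\<^sup>2) ^ s = q ^ (2 * s + 2)" "q * (q\<^sup>2) ^ s = q ^ (2 * s + 1)"
      by (simp_all add: power_mult power2_eq_square)
    then show ?thesis unfolding P_def qpoch_Suc by simp
  qed
  \<comment> \<open>The antidifference in \<open>s\<close> of the change of the \<open>s\<close>-th term.\<close>
  define U where "U s = P n / (1 - q ^ (2 * n + 1)) * (q ^ (s * (2 * n + 1)) * (1 - q ^ (2 * s)) / P s)" for s
  have step: "P (Suc n) / P s * q ^ (s * (2 * Suc n + 1)) - P n / P s * q ^ (s * (2 * n + 1))
      = U (Suc s) - U s" for s
  proof -
    have U_Suc: "U (Suc s) = P n / (1 - q ^ (2 * n + 1)) *
        (q ^ (s * (2 * n + 1)) * q ^ (2 * n + 1) * (1 - q ^ (2 * s + 1)) / P s)"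
    proof -
      have "2 * Suc s = 2 * s + 2" "Suc s * (2 * n + 1) = s * (2 * n + 1) + (2 * n + 1)" by simp_all
      then show ?thesis
        using nz[of "2 * s + 2"] nz[of "2 * s + 1"] Pnz[of s]
        unfolding U_def P_Suc by (simp only: power_add[of q "s * (2 * n + 1)" "2 * n + 1"])
          (simp add: divide_simps del: right_minus_eq power_Suc)
    qed
    have e: "q ^ (s * (2 * Suc n + 1)) = q ^ (s * (2 * n + 1)) * q ^ (2 * s)"
      unfolding power_add[symmetric] by (rule arg_cong[where f = "\<lambda>m. q ^ m"]) simp
    show ?thesis
      unfolding U_Suc unfolding U_def e P_Suc using nz[of "2 * n + 1"] Pnz[of s]
      by (simp add: divide_simps del: right_minus_eq) (simp add: algebra_simps power_add)
  qed
  have "(\<Sum>s\<le>n. P (Suc n) / P s * q ^ (s * (2 * Suc n + 1))) - (\<Sum>s\<le>n. P n / P s * q ^ (s * (2 * n + 1)))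
      = (\<Sum>s\<le>n. U (Suc s) - U s)"
    unfolding sum_subtractf[symmetric] by (rule sum.cong[OF refl step])
  also have "\<dots> = U (Suc n) - U 0"
    unfolding lessThan_Suc_atMost[symmetric] by (rule sum_lessThan_telescope)
  also have "U 0 = 0" by (simp add: U_def)
  also have "U (Suc n) = q ^ (Suc n * (2 * n + 1))"
  proof -
    have "2 * Suc n = 2 * n + 2" by simp
    then show ?thesis
      using nz[of "2 * n + 2"] nz[of "2 * n + 1"] Pnz[of n] unfolding U_def P_Suc
      by (simp only:) (simp add: divide_simps del: right_minus_eq power_Suc)
  qed
  also have "Suc n * (2 * n + 1) = triangle (2 * n + 1)"
    using double_triangle[of "2 * n + 1"] by simp
  finally have "(\<Sum>s\<le>n. P (Suc n) / P s * q ^ (s * (2 * Suc n + 1)))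
      = (\<Sum>s\<le>2 * n. q ^ triangle s) + q ^ triangle (2 * n + 1)"
    using Suc by (simp add: algebra_simps)
  moreover have "P (Suc n) / P (Suc n) * q ^ (Suc n * (2 * Suc n + 1)) = q ^ triangle (2 * Suc n)"
    using Pnz[of "Suc n"] by (simp only: triangle_double) simp
  moreover have "2 * Suc n = Suc (Suc (2 * n))" by simp
  ultimately show ?case by (simp only: sum.atMost_Suc) simp
qed

theorem gauss_psi:
  assumes q: "norm q < 1"
  shows "psi q = qpinf (q\<^sup>2) (q\<^sup>2) / qpinf q (q\<^sup>2)"
    and "(\<lambda>n. of_bool (n \<in> range triangle) * q ^ n) sums psi q"
proof -
  have q2: "norm (q\<^sup>2) < 1" using q by (simp add: norm_power power_less_one_iff)
  define P where "P n = qpoch (q\<^sup>2) (q\<^sup>2) n / qpoch q (q\<^sup>2) n" for n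
  have lim: "P \<longlonglongrightarrow> qpinf (q\<^sup>2) (q\<^sup>2) / qpinf q (q\<^sup>2)" (is "_ \<longlonglongrightarrow> ?L")
    unfolding P_def by (intro tendsto_divide qpoch_LIMSEQ q2 qpinf_nonzero q)
  have Lnz: "?L \<noteq> 0" using qpinf_nonzero[OF q q2] qpinf_nonzero[OF q2 q2] by simp
  have "Bseq P" using lim convergentI convergent_imp_Bseq by blast
  then obtain B where B: "norm (P n) \<le> B" for n by (auto simp: Bseq_def)
  have "Bseq (\<lambda>n. inverse (P n))"
    using tendsto_inverse[OF lim Lnz] convergentI convergent_imp_Bseq by blast
  then obtain B' where B': "norm (inverse (P n)) \<le> B'" for n by (auto simp: Bseq_def)
  have B0: "0 \<le> B" "0 \<le> B'" using order_trans[OF norm_ge_zero B] order_trans[OF norm_ge_zero B'] by auto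
  have sm: "summable (\<lambda>s. norm q ^ s)" using q by (intro summable_geometric) auto
  define C where "C = B * B' * (\<Sum>s. norm q ^ s)"
  define A where "A n = (\<Sum>s\<le>n. P n / P s * q ^ (s * (2 * n + 1)))" for n
  have Pnz: "P n \<noteq> 0" for n
    unfolding P_def using qpoch_nonzero[OF q q2] qpoch_nonzero[OF q2 q2] by simp
  \<comment> \<open>For \<open>s \<ge> 1\<close> the exponent \<open>s (2n + 1)\<close> is at least \<open>n + s\<close>, and \<open>P n / P s\<close> is bounded.\<close>
  have dist: "norm (A n - P n) \<le> C * norm q ^ n" for n
  proof -
    have "A n - P n = (\<Sum>s\<in>{..n} - {0}. P n / P s * q ^ (s * (2 * n + 1)))"
      unfolding A_def by (subst sum.remove[of _ 0]) (auto simp: P_def)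
    also have "norm \<dots> \<le> (\<Sum>s\<in>{..n} - {0}. B * B' * (norm q ^ n * norm q ^ s))"
    proof (rule sum_norm_le)
      fix s assume "s \<in> {..n} - {0}"
      then have "n + s \<le> s * (2 * n + 1)" by (cases s) auto
      then have "norm q ^ (s * (2 * n + 1)) \<le> norm q ^ (n + s)"
        using q by (intro power_decreasing) auto
      then show "norm (P n / P s * q ^ (s * (2 * n + 1))) \<le> B * B' * (norm q ^ n * norm q ^ s)"
        unfolding norm_mult norm_power divide_inverse power_add
        using B[of n] B'[of s] B0 by (intro mult_mono) auto
    qed
    also have "\<dots> = B * B' * norm q ^ n * (\<Sum>s\<in>{..n} - {0}. norm q ^ s)"
      by (simp add: sum_distrib_left mult_ac)
    also have "\<dots> \<le> B * B' * norm q ^ n * (\<Sum>s. norm q ^ s)"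
      using B0 sm by (intro mult_left_mono sum_le_suminf) auto
    finally show ?thesis by (simp add: C_def mult_ac)
  qed
  have "(\<lambda>n. C * norm q ^ n) \<longlonglongrightarrow> C * 0"
    using q by (intro tendsto_mult tendsto_const LIMSEQ_power_zero) auto
  then have "(\<lambda>n. A n - P n) \<longlonglongrightarrow> 0"
    using dist by (intro Lim_null_comparison[of "\<lambda>n. A n - P n" "\<lambda>n. C * norm q ^ n"]) auto
  from tendsto_add[OF this lim] have "A \<longlonglongrightarrow> ?L" by simp
  then have A: "(\<lambda>n. \<Sum>s\<le>2 * n. q ^ triangle s) \<longlonglongrightarrow> ?L"
    unfolding A_def P_def shanks_identity[OF q] .
  have "summable (\<lambda>n. of_bool (n \<in> range triangle) * q ^ n)"
    by (rule summable_comparison_test'[OF sm]) (auto simp: norm_mult norm_power)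
  then show s: "(\<lambda>n. of_bool (n \<in> range triangle) * q ^ n) sums psi q"
    unfolding psi_def by (rule summable_sums)
  then have "(\<lambda>n. of_bool (triangle n \<in> range triangle) * q ^ triangle n) sums psi q"
    by (subst (asm) sums_mono_reindex[OF strict_mono_triangle, symmetric]) auto
  then have "(\<lambda>n. \<Sum>s\<le>n. q ^ triangle s) \<longlonglongrightarrow> psi q"
    by (simp add: sums_def LIMSEQ_lessThan_iff_atMost)
  from LIMSEQ_subseq_LIMSEQ[OF this, of "\<lambda>n. 2 * n"]
  have "(\<lambda>n. \<Sum>s\<le>2 * n. q ^ triangle s) \<longlonglongrightarrow> psi q"
    by (simp add: strict_mono_def o_def)
  with A show "psi q = ?L" using LIMSEQ_unique by blast
qed

section \<open>Summation of the double series by rows\<close>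

definition F2_row :: "complex \<Rightarrow> nat \<Rightarrow> complex" where
  "F2_row q n = (\<Sum>\<^sub>\<infinity>k. F2_term q k n)"

lemma F2_rows_sums:
  assumes "norm q < 1"
  shows "(\<lambda>k. F2_term q k n) sums F2_row q n" and "F2_row q sums F2_gf q"
proof -
  have "((\<lambda>(k, n). F2_term q k n) has_sum F2_gf q) (UNIV \<times> UNIV)"
    using F2_term_has_sum[OF assms] by simp
  then have hs: "((\<lambda>(n, k). F2_term q k n) has_sum F2_gf q) (UNIV \<times> UNIV)"
    by (subst (asm) has_sum_swap) simp
  have "(\<lambda>k. F2_term q k n) summable_on UNIV" for n
    by (rule summable_on_SigmaD1[OF has_sum_imp_summable[OF hs]]) simp
  then have rows: "((\<lambda>k. F2_term q k n) has_sum F2_row q n) UNIV" for n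
    unfolding F2_row_def by (rule has_sum_infsum)
  then show "(\<lambda>k. F2_term q k n) sums F2_row q n" by (rule has_sum_imp_sums)
  have "(F2_row q has_sum F2_gf q) UNIV"
    by (rule has_sum_SigmaD[OF hs]) (use rows in simp)
  then show "F2_row q sums F2_gf q" by (rule has_sum_imp_sums)
qed

text \<open>
  The quotient of infinite products that remains of the \<open>n\<close>-th row after summation over \<open>k\<close>.
\<close>

definition tail_ratio :: "complex \<Rightarrow> nat \<Rightarrow> complex" where
  "tail_ratio q n = qpinf (q ^ (2 * n + 2)) (q\<^sup>2) / qpinf (q ^ (2 * n + 3)) (q\<^sup>2)"

lemma F2_row_closed_form:
  assumes q: "norm q < 1" "q \<noteq> 0"
  shows "(1 - q) * q ^ n * F2_row q n = (1 - q ^ (2 * n + 3)) * (1 - tail_ratio q n)"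
proof -
  have pw: "norm (q ^ m) < 1" if "0 < m" for m
    using q that by (simp add: norm_power power_less_one_iff)
  have cp: "q ^ (2 * n + 3) * q\<^sup>2 = q ^ (2 * n + 5)"
    by (simp add: eval_nat_numeral mult_ac)
  have "(\<lambda>k. (q ^ (2 * n + 3) - q ^ (2 * n + 2)) *
        (qpoch (q ^ (2 * n + 2)) (q\<^sup>2) k / qpoch (q ^ (2 * n + 5)) (q\<^sup>2) k * (q\<^sup>2) ^ k))
      sums ((1 - q ^ (2 * n + 3)) * (tail_ratio q n - 1))"
    unfolding tail_ratio_def cp[symmetric] by (rule q_telescoping_sums) (auto intro: pw)
  moreover have "(q ^ (2 * n + 3) - q ^ (2 * n + 2)) *
        (qpoch (q ^ (2 * n + 2)) (q\<^sup>2) k / qpoch (q ^ (2 * n + 5)) (q\<^sup>2) k * (q\<^sup>2) ^ k)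
      = - ((1 - q) * q ^ n) * F2_term q k n" for k
  proof -
    have "(q ^ (2 * n + 3) - q ^ (2 * n + 2)) * (q\<^sup>2) ^ k = - ((1 - q) * q ^ n) * q ^ (2 * k + n + 2)"
      by (simp add: power_add power_mult algebra_simps mult_2 power2_eq_square power3_eq_cube)
    note e = this
    have "(q ^ (2 * n + 3) - q ^ (2 * n + 2)) *
        (qpoch (q ^ (2 * n + 2)) (q\<^sup>2) k / qpoch (q ^ (2 * n + 5)) (q\<^sup>2) k * (q\<^sup>2) ^ k)
      = qpoch (q ^ (2 * n + 2)) (q\<^sup>2) k / qpoch (q ^ (2 * n + 5)) (q\<^sup>2) k *
        ((q ^ (2 * n + 3) - q ^ (2 * n + 2)) * (q\<^sup>2) ^ k)"
      by (simp only: mult_ac)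
    then show ?thesis unfolding e F2_term_def by (simp only: mult_ac)
  qed
  ultimately have "(\<lambda>k. - ((1 - q) * q ^ n) * F2_term q k n) sums ((1 - q ^ (2 * n + 3)) * (tail_ratio q n - 1))"
    by simp
  moreover have "(\<lambda>k. - ((1 - q) * q ^ n) * F2_term q k n) sums (- ((1 - q) * q ^ n) * F2_row q n)"
    by (intro sums_mult F2_rows_sums q)
  ultimately have "- ((1 - q) * q ^ n) * F2_row q n = (1 - q ^ (2 * n + 3)) * (tail_ratio q n - 1)"
    by (rule sums_unique2[symmetric])
  then show ?thesis by (simp add: algebra_simps)
qed

lemma tail_ratio_Suc:
  assumes q: "norm q < 1"
  shows "tail_ratio q (Suc n) = tail_ratio q n * (1 - q ^ (2 * n + 3)) / (1 - q ^ (2 * n + 2))"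
proof -
  have q2: "norm (q\<^sup>2) < 1" using q by (simp add: norm_power power_less_one_iff)
  have "q ^ (2 * Suc n + 2) = q ^ (2 * n + 2) * q\<^sup>2" "q ^ (2 * Suc n + 3) = q ^ (2 * n + 3) * q\<^sup>2"
    by (simp_all add: eval_nat_numeral mult_ac)
  from this show ?thesis
    using one_minus_pos_power_nonzero[OF q, of "2 * n + 2"] one_minus_pos_power_nonzero[OF q, of "2 * n + 3"]
    unfolding tail_ratio_def qpinf_rec[OF q2, of "q ^ (2 * n + 2)"] qpinf_rec[OF q2, of "q ^ (2 * n + 3)"]
    by (simp only:) (simp add: divide_simps del: right_minus_eq power_Suc)
qed

text \<open>
  By the closed form of the rows, \<open>(1 - q)\<close> times the series is the sum of
  \<open>(q\<^bsup>-n\<^esup> - q\<^bsup>n+3\<^esup>) (1 - tail_ratio q n)\<close>. Here the first factor has the partial sums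
  \<open>q\<^bsup>-n\<^esup> (1 - q\<^bsup>n+1\<^esup>) (1 - q\<^bsup>n+3\<^esup>) / (1 - q)\<close>, and the differences of the second are multiples of
  \<open>tail_ratio q n\<close> by \<open>tail_ratio_Suc\<close>: summation by parts removes the constant \<open>1\<close>.
\<close>

lemma F2_gf_single_sum:
  assumes q: "norm q < 1" "q \<noteq> 0"
  shows "(\<lambda>m. q ^ (m + 2) * (1 - q ^ (m + 3)) / ((1 - q) * (1 + q ^ (m + 1))) * tail_ratio q m) sums F2_gf q"
proof -
  \<comment> \<open>The boundary term of the summation by parts. Expressed through the row itself it visibly tends
    to 0, which would be hidden by the factor \<open>q\<^bsup>-n\<^esup>\<close>.\<close>
  define V where "V n = - (q * (1 - q ^ n) * (1 - q ^ (n + 2)) * F2_row q n) / ((1 - q) * (1 - q ^ (2 * n + 3)))" for n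
  note nz = one_minus_pos_power_nonzero[OF q(1)]
  have V0: "F2_row q \<longlonglongrightarrow> 0" using F2_rows_sums(2)[OF q(1)] sums_summable summable_LIMSEQ_zero by blast
  have qn: "(\<lambda>n. q ^ (a * n + b)) \<longlonglongrightarrow> 0" if "0 < a" for a b
  proof -
    have "norm (q ^ a) < 1" using q that by (simp add: norm_power power_less_one_iff)
    from tendsto_mult[OF LIMSEQ_power_zero[OF this] tendsto_const, of "q ^ b"]
    show ?thesis by (simp add: power_add power_mult)
  qed
  have "V \<longlonglongrightarrow> - (q * (1 - 0) * (1 - 0) * 0) / ((1 - q) * (1 - 0))"
    unfolding V_def using qn[of 1 0] qn[of 1 2] qn[of 2 3] V0 nz[of 1] q(1)
    by (intro tendsto_intros) (simp_all del: power_Suc)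
  then have "V \<longlonglongrightarrow> 0" by simp
  from telescope_sums[OF this] have tel: "(\<lambda>n. V (Suc n) - V n) sums 0"
    by (simp add: V_def)
  \<comment> \<open>An identity of rational functions in \<open>q\<close>, \<open>x = q\<^sup>m\<close> and \<open>g = tail_ratio q m\<close>.\<close>
  have key: "F2_row q m + (V (Suc m) - V m) =
      q ^ (m + 2) * (1 - q ^ (m + 3)) / ((1 - q) * (1 + q ^ (m + 1))) * tail_ratio q m" for m
  proof -
    define x where "x = q ^ m"
    have x: "x \<noteq> 0" "q ^ (m + 1) = x * q" "q ^ (m + 2) = x * q\<^sup>2" "q ^ (m + 3) = x * q ^ 3"
      "q ^ (2 * m + 2) = x\<^sup>2 * q\<^sup>2" "q ^ (2 * m + 3) = x\<^sup>2 * q ^ 3" "q ^ (2 * m + 5) = x\<^sup>2 * q ^ 5"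
      unfolding x_def power_add power_even_eq using q by simp_all
    have n: "1 - q \<noteq> 0" "1 - x * q \<noteq> 0" "1 - x\<^sup>2 * q\<^sup>2 \<noteq> 0" "1 - x\<^sup>2 * q ^ 3 \<noteq> 0" "1 - x\<^sup>2 * q ^ 5 \<noteq> 0"
      using nz[of 1] nz[of "m + 1"] nz[of "2 * m + 2"] nz[of "2 * m + 3"] nz[of "2 * m + 5"]
      unfolding x by simp_all
    have fac: "1 - x\<^sup>2 * q\<^sup>2 = (1 - x * q) * (1 + x * q)"
      by (simp add: algebra_simps power2_eq_square)
    with n(3) have n': "1 + x * q \<noteq> 0" by (metis mult_zero_right)
    define g where "g = tail_ratio q m"
    have r0: "F2_row q m = (1 - x\<^sup>2 * q ^ 3) * (1 - g) / ((1 - q) * x)"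
      using F2_row_closed_form[OF q, of m] n x(1) unfolding x x_def[symmetric] g_def[symmetric]
      by (simp add: field_simps)
    have e: "2 * Suc m + 3 = 2 * m + 5" "Suc m = m + 1" "Suc m + 2 = m + 3" by simp_all
    have G1: "tail_ratio q (Suc m) = g * (1 - x\<^sup>2 * q ^ 3) / (1 - x\<^sup>2 * q\<^sup>2)"
      unfolding tail_ratio_Suc[OF q(1)] g_def x ..
    have r1: "F2_row q (Suc m) = (1 - x\<^sup>2 * q ^ 5) * (1 - tail_ratio q (Suc m)) / ((1 - q) * (x * q))"
      using F2_row_closed_form[OF q, of "Suc m"] n x(1) q(2) unfolding e(1) unfolding e(2) unfolding x
      by (simp add: field_simps)
    have V1: "V (Suc m) = - ((1 - x * q) * (1 - x * q ^ 3) * (1 - tail_ratio q (Suc m))) / ((1 - q)\<^sup>2 * x)"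
      unfolding V_def r1 e(1) e(3) unfolding e(2) x using n x(1) q(2)
      by (simp add: divide_simps del: right_minus_eq) (simp add: power2_eq_square mult_ac)
    have V0: "V m = - (q * (1 - x) * (1 - x * q\<^sup>2) * (1 - g)) / ((1 - q)\<^sup>2 * x)"
      unfolding V_def r0 x x_def[symmetric] using n x(1)
      by (simp add: divide_simps del: right_minus_eq) (simp add: power2_eq_square mult_ac)
    have "(1 - x * q) * (1 - tail_ratio q (Suc m)) = (1 - x * q) - g * (1 - x\<^sup>2 * q ^ 3) / (1 + x * q)"
    proof -
      have "a * (1 - w / (a * c)) = a - w / c" if "a \<noteq> 0" "c \<noteq> 0" for a c w :: complex
        using that by (simp add: field_simps)
      from this[OF n(2) n'] show ?thesis unfolding G1 fac .
    qed
    moreover have "(1 - x * q) * (1 - x * q ^ 3) * (1 - tail_ratio q (Suc m))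
        = ((1 - x * q) * (1 - tail_ratio q (Suc m))) * (1 - x * q ^ 3)" by (simp only: mult_ac)
    ultimately have V1': "V (Suc m) = - (((1 - x * q) - g * (1 - x\<^sup>2 * q ^ 3) / (1 + x * q)) * (1 - x * q ^ 3))
        / ((1 - q)\<^sup>2 * x)"
      unfolding V1 by (simp only:)
    show ?thesis
      unfolding r0 V1' V0 x g_def[symmetric]
      using n(1) n' x(1) by (simp add: divide_simps del: right_minus_eq)
        (simp add: algebra_simps power2_eq_square eval_nat_numeral)
  qed
  from sums_add[OF F2_rows_sums(2)[OF q(1)] tel] show ?thesis
    unfolding key by simp
qed

section \<open>The generating function in closed form\<close>

lemma tail_ratio_eq_qpoch:
  assumes q: "norm q < 1"
  shows "tail_ratio q n = tail_ratio q 0 * (qpoch (q ^ 3) (q\<^sup>2) n / qpoch (q\<^sup>2) (q\<^sup>2) n)"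
proof (induction n)
  case (Suc n)
  have "q ^ 3 * (q\<^sup>2) ^ n = q ^ (2 * n + 3)" "q\<^sup>2 * (q\<^sup>2) ^ n = q ^ (2 * n + 2)"
    by (subst mult.commute, simp only: power_add power_mult)+
  then show ?case unfolding tail_ratio_Suc[OF q] qpoch_Suc Suc by simp
qed simp

text \<open>
  In the single sum write \<open>1 - q\<^bsup>m+3\<^esup> = (1 + q\<^bsup>m+1\<^esup>) - q\<^bsup>m+1\<^esup> (1 + q\<^sup>2)\<close>. The first part cancels the
  denominator; in the second part \<open>1 / (1 + q\<^bsup>m+1\<^esup>) = (1 - q\<^bsup>m+1\<^esup>) / (1 - q\<^bsup>2m+2\<^esup>)\<close>, and the new
  denominator completes the q-shifted factorials to those of index \<open>m + 1\<close>. What results are three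
  series to which the q-binomial theorem applies, with arguments \<open>q\<close>, \<open>q\<^sup>2\<close> and \<open>q\<^sup>3\<close>. Every product that
  occurs is a rational function of \<open>q\<close> times \<open>(q\<^sup>3;q\<^sup>2)\<^sub>\<infinity>\<close> or \<open>(q\<^sup>4;q\<^sup>2)\<^sub>\<infinity>\<close>, and only their quotient
  survives, which Gauss's identity expresses through \<open>psi q\<close>.
\<close>

theorem F2_gf_closed_form:
  assumes q: "norm q < 1" "q \<noteq> 0"
  shows "(1 - q) * (1 - q\<^sup>2) * F2_gf q
    = (q + q\<^sup>2 + q ^ 3) * (1 - q) * (psi q)\<^sup>2 - q * (1 + q\<^sup>2) * (1 + q)"
proof -
  define p where "p = q\<^sup>2"
  have p: "norm p < 1" using q by (simp add: p_def norm_power power_less_one_iff)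
  note nz = one_minus_pos_power_nonzero[OF q(1)]
  have qm: "norm (q ^ m) < 1" if "0 < m" for m
    using q that by (simp add: norm_power power_less_one_iff)
  have q1: "1 - q \<noteq> 0" and q2: "1 - q\<^sup>2 \<noteq> 0" using nz[of 1] nz[of 2] by auto
  define a b where "a = qpinf (q ^ 3) p" and "b = qpinf (q ^ 4) p"
  have a: "a \<noteq> 0" and b: "b \<noteq> 0" unfolding a_def b_def by (intro qpinf_nonzero qm p; simp)+
  have I1: "qpinf q p = (1 - q) * a"
  proof -
    have "q * p = q ^ 3" by (simp add: p_def eval_nat_numeral)
    then show ?thesis unfolding a_def using qpinf_rec[OF p, of q] by simp
  qed
  have I2: "qpinf (q\<^sup>2) p = (1 - q\<^sup>2) * b"
    unfolding b_def using qpinf_rec[OF p, of "q\<^sup>2"] by (simp add: p_def flip: power_add)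
  have psi: "psi q = (1 + q) * b / a"
  proof -
    have "psi q = (1 - q\<^sup>2) * b / ((1 - q) * a)"
      unfolding gauss_psi[OF q(1)] I1[unfolded p_def] I2[unfolded p_def] ..
    also have "1 - q\<^sup>2 = (1 - q) * (1 + q)" by (simp add: algebra_simps power2_eq_square)
    finally show ?thesis using q1 by simp
  qed
  have G0: "tail_ratio q 0 = (1 - q\<^sup>2) * b / a"
  proof -
    have "2 * 0 + 2 = (2::nat)" "2 * 0 + 3 = (3::nat)" by simp_all
    then show ?thesis unfolding tail_ratio_def I2[symmetric] a_def p_def by (simp only:)
  qed
  define c e where "c n = qpoch (q ^ 3) p n / qpoch p p n" and "e n = qpoch q p n / qpoch p p n" for n
  have s1: "(\<lambda>n. c n * q ^ n) sums (b / ((1 - q) * a))"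
  proof -
    have "q ^ 3 * q = q ^ 4" by (simp add: eval_nat_numeral)
    then show ?thesis using q_binomial[OF p q(1), of "q ^ 3"] unfolding I1 c_def b_def by simp
  qed
  have s2: "(\<lambda>n. e n * (q\<^sup>2) ^ n) sums (a / ((1 - q\<^sup>2) * b))"
  proof -
    have "q * q\<^sup>2 = q ^ 3" by (simp add: eval_nat_numeral)
    then show ?thesis using q_binomial[OF p qm[of 2], of q] unfolding I2 e_def a_def by simp
  qed
  have s3: "(\<lambda>n. e n * (q ^ 3) ^ n) sums (b / a)"
  proof -
    have "q * q ^ 3 = q ^ 4" by (simp add: eval_nat_numeral)
    then show ?thesis using q_binomial[OF p qm[of 3], of q] unfolding e_def a_def b_def by simp
  qed
  \<comment> \<open>The terms with index 0 of the two series cancel, so the difference may start at index 1.\<close>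
  have s4: "(\<lambda>n. e (Suc n) * (q\<^sup>2) ^ Suc n - e (Suc n) * (q ^ 3) ^ Suc n) sums (a / ((1 - q\<^sup>2) * b) - b / a)"
  proof -
    have "(\<lambda>n. e n * (q\<^sup>2) ^ n - e n * (q ^ 3) ^ n) sums (a / ((1 - q\<^sup>2) * b) - b / a)"
      by (intro sums_diff s2 s3)
    then show ?thesis by (subst sums_Suc_iff) simp
  qed
  have e_Suc: "e (Suc m) * (1 - q ^ (2 * m + 2)) = c m * (1 - q)" for m
  proof -
    have "p * p ^ m = q ^ (2 * m + 2)" by (simp add: p_def power_mult power2_eq_square)
    moreover have "q * p = q ^ 3" by (simp add: p_def eval_nat_numeral)
    ultimately show ?thesis
      unfolding e_def c_def qpoch_rec[of q p m] qpoch_Suc[of p p m]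
      using nz[of "2 * m + 2"] qpoch_nonzero[OF p p, of m]
      by (simp add: divide_simps del: right_minus_eq power_Suc)
  qed
  have term_eq: "q ^ (m + 2) * (1 - q ^ (m + 3)) / ((1 - q) * (1 + q ^ (m + 1))) * tail_ratio q m
      = q\<^sup>2 * tail_ratio q 0 / (1 - q) * (c m * q ^ m
          - (1 + q\<^sup>2) / (q * (1 - q)) * (e (Suc m) * (q\<^sup>2) ^ Suc m - e (Suc m) * (q ^ 3) ^ Suc m))" for m
  proof -
    define x where "x = q ^ (m + 1)"
    have "2 * m + 2 = (m + 1) * 2" by simp
    then have pw1: "q ^ (2 * m + 2) = x\<^sup>2" unfolding x_def by (simp only: power_mult)
    have x: "1 - x \<noteq> 0" "1 + x \<noteq> 0"
    proof -
      show "1 - x \<noteq> 0" unfolding x_def by (rule nz) simp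
      have "(1 - x) * (1 + x) = 1 - q ^ (2 * m + 2)"
        unfolding pw1 by (simp add: algebra_simps power2_eq_square)
      with nz[of "2 * m + 2"] show "1 + x \<noteq> 0" by (metis mult_zero_right zero_less_Suc add_2_eq_Suc')
    qed
    have pw2: "q ^ (m + 2) = q * x" "q ^ (m + 3) = q\<^sup>2 * x" "q ^ m = x / q"
      using q(2) unfolding x_def by (simp_all add: eval_nat_numeral)
    have pw3: "(q ^ i) ^ Suc m = x ^ i" for i
      unfolding x_def power_mult[symmetric] by (simp add: mult.commute)
    note pw = pw1 pw2 pw3
    have e1: "e (Suc m) = c m * (1 - q) / ((1 - x) * (1 + x))"
    proof -
      have "1 - x\<^sup>2 = (1 - x) * (1 + x)" by (simp add: algebra_simps power2_eq_square)
      then have "e (Suc m) * ((1 - x) * (1 + x)) = c m * (1 - q)" using e_Suc[of m] unfolding pw1 by simp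
      moreover have "(1 - x) * (1 + x) \<noteq> 0" using x by (simp del: right_minus_eq)
      ultimately show ?thesis using nonzero_eq_divide_eq by blast
    qed
    have "e (Suc m) * x\<^sup>2 - e (Suc m) * x ^ 3 = e (Suc m) * (1 - x) * x\<^sup>2"
      by (simp add: algebra_simps eval_nat_numeral)
    also have "\<dots> = c m * (1 - q) * x\<^sup>2 / (1 + x)" unfolding e1 using x by simp
    finally have e2: "e (Suc m) * x\<^sup>2 - e (Suc m) * x ^ 3 = c m * (1 - q) * x\<^sup>2 / (1 + x)" .
    have G: "tail_ratio q m = tail_ratio q 0 * c m" unfolding c_def p_def by (rule tail_ratio_eq_qpoch[OF q(1)])
    define g where "g = tail_ratio q 0"
    show ?thesis
      unfolding G pw e2 g_def[symmetric] unfolding x_def[symmetric]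
      using q1 x q(2) by (simp add: divide_simps del: right_minus_eq)
        (simp add: algebra_simps eval_nat_numeral)
  qed
  define r where "r = b / a"
  have g1: "tail_ratio q 0 * (b / ((1 - q) * a)) = (1 - q\<^sup>2) * r\<^sup>2 / (1 - q)"
    unfolding G0 r_def by (simp add: power2_eq_square mult_ac)
  have g2: "tail_ratio q 0 * (a / ((1 - q\<^sup>2) * b) - b / a) = 1 - (1 - q\<^sup>2) * r\<^sup>2"
    unfolding G0 r_def right_diff_distrib using a b q2 by (simp add: power2_eq_square del: right_minus_eq)
  have "F2_gf q = q\<^sup>2 * tail_ratio q 0 / (1 - q) * (b / ((1 - q) * a)
          - (1 + q\<^sup>2) / (q * (1 - q)) * (a / ((1 - q\<^sup>2) * b) - b / a))"
    using F2_gf_single_sum[OF q] unfolding term_eq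
    by (rule sums_unique2) (intro sums_mult sums_diff s1 s4)
  also have "\<dots> = q\<^sup>2 / (1 - q) * (tail_ratio q 0 * (b / ((1 - q) * a)))
      - q\<^sup>2 * (1 + q\<^sup>2) / (q * (1 - q)\<^sup>2) * (tail_ratio q 0 * (a / ((1 - q\<^sup>2) * b) - b / a))"
  proof -
    have "u * g / v * (y - s / (q * v) * z) = u / v * (g * y) - u * s / (q * v\<^sup>2) * (g * z)"
      for u g v s y z :: complex
      by (simp add: right_diff_distrib power2_eq_square mult_ac)
    then show ?thesis .
  qed
  also have "\<dots> = q\<^sup>2 / (1 - q) * ((1 - q\<^sup>2) * r\<^sup>2 / (1 - q))
      - q * (1 + q\<^sup>2) / (1 - q)\<^sup>2 * (1 - (1 - q\<^sup>2) * r\<^sup>2)"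
    unfolding g1 g2 using q(2) by (simp add: power2_eq_square)
  also have "\<dots> = q * (1 + q\<^sup>2 + q) * (1 - q\<^sup>2) * r\<^sup>2 / (1 - q)\<^sup>2 - q * (1 + q\<^sup>2) / (1 - q)\<^sup>2"
    using q1 by (simp add: divide_simps del: right_minus_eq) (simp add: algebra_simps eval_nat_numeral)
  finally have F: "F2_gf q = q * (1 + q\<^sup>2 + q) * (1 - q\<^sup>2) * r\<^sup>2 / (1 - q)\<^sup>2 - q * (1 + q\<^sup>2) / (1 - q)\<^sup>2" .
  have psi_r: "psi q = (1 + q) * r" unfolding psi r_def by simp
  have fac: "1 - q\<^sup>2 = (1 - q) * (1 + q)" by (simp add: algebra_simps power2_eq_square)
  show ?thesis
    unfolding F psi_r fac using q1
    by (simp add: divide_simps del: right_minus_eq) (simp add: algebra_simps eval_nat_numeral)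
qed

section \<open>The coefficients as lattice point counts\<close>

definition pairs_le :: "nat \<Rightarrow> (nat \<times> nat) set" where
  "pairs_le m = {(a, b). triangle a + triangle b \<le> m}"

text \<open>
  The pairs counted by the coefficient of \<open>q\<^sup>m\<close> in \<open>\<psi>(q)\<^sup>2 / (1 - q\<^sup>2)\<close>.
\<close>

definition pairs_parity :: "nat \<Rightarrow> (nat \<times> nat) set" where
  "pairs_parity m = {(a, b). triangle a + triangle b \<le> m \<and> even (triangle a + triangle b + m)}"

lemma le_triangle: "n \<le> triangle n"
  by (rule strict_mono_imp_increasing[OF strict_mono_triangle])

lemma finite_pairs_le: "finite (pairs_le m)"
proof (rule finite_subset)
  show "pairs_le m \<subseteq> {..m} \<times> {..m}"
  proof
    fix z assume "z \<in> pairs_le m"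
    with le_triangle[of "fst z"] le_triangle[of "snd z"] show "z \<in> {..m} \<times> {..m}"
      by (auto simp: pairs_le_def)
  qed
qed simp

lemma finite_pairs_parity: "finite (pairs_parity m)"
  by (rule finite_subset[OF _ finite_pairs_le[of m]]) (auto simp: pairs_parity_def pairs_le_def)

text \<open>
  Transfers identities between analytic functions to identities between formal power series, where
  coefficients can be compared.
\<close>

lemma has_fps_expansion_of_sums:
  fixes f :: "complex \<Rightarrow> complex"
  assumes "\<And>q. norm q < 1 \<Longrightarrow> (\<lambda>n. c n * q ^ n) sums f q"
  shows "f has_fps_expansion Abs_fps c"
  unfolding has_fps_expansion_def
proof
  have "norm (1/2 :: complex) \<le> conv_radius c"
    by (rule conv_radius_geI[OF sums_summable[OF assms]]) (simp add: norm_divide)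
  then show "0 < fps_conv_radius (Abs_fps c)"
    by (simp add: fps_conv_radius_def norm_divide) (metis ereal_less(2) half_gt_zero less_le_trans zero_less_one)
  have "eventually (\<lambda>z :: complex. z \<in> ball 0 1) (nhds 0)"
    by (rule eventually_nhds_in_open) auto
  then show "\<forall>\<^sub>F z in nhds 0. eval_fps (Abs_fps c) z = f z"
  proof (rule eventually_mono)
    fix z :: complex assume "z \<in> ball 0 1"
    then show "eval_fps (Abs_fps c) z = f z"
      using sums_unique[OF assms[of z]] by (simp add: eval_fps_def)
  qed
qed

definition psi_fps :: "complex fps" where
  "psi_fps = Abs_fps (\<lambda>n. of_bool (n \<in> range triangle))"

definition pair_count :: "nat \<Rightarrow> nat" where
  "pair_count m = card {(a, b). triangle a + triangle b = m}"

lemma inj_triangle: "inj triangle"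
  using strict_mono_imp_inj_on[OF strict_mono_triangle] .

lemma psi_fps_square_nth: "fps_nth (psi_fps\<^sup>2) m = of_nat (pair_count m)"
proof -
  have "fps_nth (psi_fps\<^sup>2) m
      = (\<Sum>i=0..m. of_bool (i \<in> range triangle \<and> m - i \<in> range triangle))"
    unfolding power2_eq_square fps_mult_nth psi_fps_def by (intro sum.cong) auto
  also have "\<dots> = of_nat (card {i \<in> {0..m}. i \<in> range triangle \<and> m - i \<in> range triangle})"
    by (simp add: Int_def)
  also have "card {i \<in> {0..m}. i \<in> range triangle \<and> m - i \<in> range triangle} = pair_count m"
    unfolding pair_count_def
  proof (rule bij_betw_same_card[OF bij_betw_imageI[of "\<lambda>(a, b). triangle a", THEN bij_betw_inv_into]])
    let ?S = "{(a, b). triangle a + triangle b = m}"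
    show "inj_on (\<lambda>(a, b). triangle a) ?S"
      using inj_triangle by (auto simp: inj_on_def)
    have "i \<in> (\<lambda>(a, b). triangle a) ` ?S" if "i \<le> m" "i = triangle a" "m - i = triangle b" for i a b
      using that by (intro image_eqI[of _ _ "(a, b)"]) auto
    then show "(\<lambda>(a, b). triangle a) ` ?S = {i \<in> {0..m}. i \<in> range triangle \<and> m - i \<in> range triangle}"
      by (auto simp: image_iff)
  qed
  finally show ?thesis .
qed

text \<open>
  The closed form, multiplied by \<open>1 - q\<^sup>2\<close>. The coefficients of
  \<open>q (1 + q\<^sup>2) (1 + q) / (1 - q) = (q + q\<^sup>2 + q\<^sup>3 + q\<^sup>4) / (1 - q)\<close> are the numbers \<open>min n 4\<close>.
\<close>

lemma F2_fps_identity: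
  "(1 - fps_X\<^sup>2) * Abs_fps F2
     = (fps_X + fps_X\<^sup>2 + fps_X ^ 3) * psi_fps\<^sup>2 - Abs_fps (\<lambda>n. of_nat (min n 4))" (is "?L = ?R - ?M")
proof -
  have F: "F2_gf has_fps_expansion Abs_fps F2"
    by (rule has_fps_expansion_of_sums) (rule F2_sums)
  have P: "psi has_fps_expansion psi_fps"
    unfolding psi_fps_def by (rule has_fps_expansion_of_sums) (rule gauss_psi)
  have "(\<lambda>q. (1 - q) * (1 - q\<^sup>2) * F2_gf q) has_fps_expansion (1 - fps_X) * (1 - fps_X\<^sup>2) * Abs_fps F2"
    by (intro fps_expansion_intros F)
  then have L: "fps_nth ((1 - fps_X) * (1 - fps_X\<^sup>2) * Abs_fps F2) n
      = (deriv ^^ n) (\<lambda>q. (1 - q) * (1 - q\<^sup>2) * F2_gf q) 0 / fact n" for n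
    by (rule fps_nth_fps_expansion)
  have "(\<lambda>q. (q + q\<^sup>2 + q ^ 3) * (1 - q) * (psi q)\<^sup>2 - q * (1 + q\<^sup>2) * (1 + q)) has_fps_expansion
      (fps_X + fps_X\<^sup>2 + fps_X ^ 3) * (1 - fps_X) * psi_fps\<^sup>2 - fps_X * (1 + fps_X\<^sup>2) * (1 + fps_X)"
    by (intro fps_expansion_intros P)
  moreover have "\<forall>\<^sub>F q in nhds 0. (1 - q) * (1 - q\<^sup>2) * F2_gf q
      = (q + q\<^sup>2 + q ^ 3) * (1 - q) * (psi q)\<^sup>2 - q * (1 + q\<^sup>2) * (1 + q)"
  proof -
    have "F2_gf 0 = 0" by (simp add: F2_gf_def F2_term_def case_prod_unfold)
    then have "(1 - q) * (1 - q\<^sup>2) * F2_gf q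
      = (q + q\<^sup>2 + q ^ 3) * (1 - q) * (psi q)\<^sup>2 - q * (1 + q\<^sup>2) * (1 + q)" if "norm q < 1" for q
      using F2_gf_closed_form[OF that] by (cases "q = 0") auto
    moreover have "eventually (\<lambda>z :: complex. z \<in> ball 0 1) (nhds 0)"
      by (rule eventually_nhds_in_open) auto
    ultimately show ?thesis by (auto elim: eventually_mono)
  qed
  ultimately have "(\<lambda>q. (1 - q) * (1 - q\<^sup>2) * F2_gf q) has_fps_expansion
      (fps_X + fps_X\<^sup>2 + fps_X ^ 3) * (1 - fps_X) * psi_fps\<^sup>2 - fps_X * (1 + fps_X\<^sup>2) * (1 + fps_X)"
    using has_fps_expansion_cong by fast
  from fps_nth_fps_expansion[OF this] L
  have main: "(1 - fps_X) * (1 - fps_X\<^sup>2) * Abs_fps F2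
    = (fps_X + fps_X\<^sup>2 + fps_X ^ 3) * (1 - fps_X) * psi_fps\<^sup>2 - fps_X * (1 + fps_X\<^sup>2) * (1 + fps_X)"
    by (intro fps_ext) simp
  have M: "(1 - fps_X) * ?M = fps_X * (1 + fps_X\<^sup>2) * (1 + fps_X)"
  proof (rule fps_ext)
    fix n
    have e: "fps_X * (1 + fps_X\<^sup>2) * (1 + fps_X) = fps_X + fps_X\<^sup>2 + fps_X ^ 3 + (fps_X ^ 4 :: complex fps)"
      by (simp add: algebra_simps eval_nat_numeral)
    have "of_nat (min n 4) - (if n = 0 then 0 else of_nat (min (n - 1) 4))
        = (of_bool (n \<in> {1, 2, 3, 4}) :: complex)"
    proof (cases "n \<le> 4")
      case True
      then have "n \<in> {0, 1, 2, 3, 4}" by auto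
      then show ?thesis by auto
    next
      case False
      then have "min n 4 = 4" "min (n - 1) 4 = 4" "n \<notin> {1, 2, 3, 4}" "n \<noteq> 0" by auto
      then show ?thesis by (simp only:) simp
    qed
    then show "fps_nth ((1 - fps_X) * ?M) n = fps_nth (fps_X * (1 + fps_X\<^sup>2) * (1 + fps_X)) n"
      unfolding e by (auto simp: left_diff_distrib fps_X_power_nth)
  qed
  have "(1 - fps_X) * ?L = (1 - fps_X) * (?R - ?M)"
    unfolding right_diff_distrib[of "1 - fps_X"] M using main by (simp only: mult_ac)
  moreover have "fps_nth (1 - fps_X :: complex fps) 0 \<noteq> fps_nth 0 0" by simp
  then have "(1 - fps_X :: complex fps) \<noteq> 0" by metis
  ultimately show ?thesis using mult_left_cancel by blast
qed

lemma F2_rec: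
  "F2 n - (if n < 2 then 0 else F2 (n - 2))
     = (if n < 1 then 0 else of_nat (pair_count (n - 1))) + (if n < 2 then 0 else of_nat (pair_count (n - 2)))
       + (if n < 3 then 0 else of_nat (pair_count (n - 3))) - of_nat (min n 4)"
  using arg_cong[OF F2_fps_identity, of "\<lambda>f. fps_nth f n"]
  by (simp add: left_diff_distrib distrib_right fps_X_power_mult_nth psi_fps_square_nth cong: if_cong)

lemma finite_pair_count: "finite {(a, b). triangle a + triangle b = m}"
  by (rule finite_subset[OF _ finite_pairs_le[of m]]) (auto simp: pairs_le_def)

lemma card_pairs_le_Suc: "card (pairs_le (Suc m)) = card (pairs_le m) + pair_count (Suc m)"
proof -
  have "pairs_le (Suc m) = pairs_le m \<union> {(a, b). triangle a + triangle b = Suc m}"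
    by (auto simp: pairs_le_def)
  moreover have "pairs_le m \<inter> {(a, b). triangle a + triangle b = Suc m} = {}"
    by (auto simp: pairs_le_def)
  ultimately show ?thesis
    unfolding pair_count_def using card_Un_disjoint[OF finite_pairs_le finite_pair_count] by metis
qed

lemma card_pairs_parity_Suc_Suc:
  "card (pairs_parity (Suc (Suc m))) = card (pairs_parity m) + pair_count (Suc (Suc m))"
proof -
  have "s \<le> Suc (Suc m) \<and> even (s + Suc (Suc m)) \<longleftrightarrow> s \<le> m \<and> even (s + m) \<or> s = Suc (Suc m)" for s
    by presburger
  then have "pairs_parity (Suc (Suc m)) = pairs_parity m \<union> {(a, b). triangle a + triangle b = Suc (Suc m)}"
    unfolding pairs_parity_def by blast
  moreover have "pairs_parity m \<inter> {(a, b). triangle a + triangle b = Suc (Suc m)} = {}"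
    by (auto simp: pairs_parity_def pairs_le_def)
  ultimately show ?thesis
    unfolding pair_count_def using card_Un_disjoint[OF finite_pairs_parity finite_pair_count] by metis
qed

lemma card_pairs_initial:
  "card (pairs_le 0) = pair_count 0" "card (pairs_parity 0) = pair_count 0"
  "card (pairs_parity 1) = pair_count 1"
proof -
  have "s \<le> 1 \<and> even (s + 1) \<longleftrightarrow> s = 1" for s :: nat by presburger
  then show "card (pairs_parity 1) = pair_count 1"
    unfolding pairs_parity_def pair_count_def by (simp only:)
qed (simp_all add: pairs_le_def pairs_parity_def pair_count_def cong: conj_cong)

text \<open>
  Both sides have the same increments when \<open>n\<close> grows by 2, by the recurrence for \<open>F2\<close>. The two
  initial values also follow from that recurrence, in terms of \<open>pair_count\<close>.
\<close>

lemma F2_eq_lattice_count: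
  "F2 (n + 3) + of_nat (2 * n + 4) = of_nat (card (pairs_le (n + 2)) + card (pairs_parity n))"
proof (induction n rule: induct_nat_012)
  have "card (pairs_le 1) = pair_count 0 + pair_count 1"
    using card_pairs_le_Suc[of 0] card_pairs_initial by simp
  then have le2: "card (pairs_le 2) = pair_count 0 + pair_count 1 + pair_count 2"
    using card_pairs_le_Suc[of 1] unfolding Suc_1 by simp
  {
    case 0
    have "F2 3 + 4 = of_nat (card (pairs_le 2) + card (pairs_parity 0))"
    proof -
      have "F2 1 = of_nat (pair_count 0) - 1" using F2_rec[of 1] by simp
      moreover have "F2 3 = F2 1 + of_nat (pair_count 2) + of_nat (pair_count 1) + of_nat (pair_count 0) - 3"
        using F2_rec[of 3] by (simp add: algebra_simps)
      ultimately show ?thesis by (simp add: card_pairs_initial le2)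
    qed
    then show ?case by (simp only: add_0 mult_0_right of_nat_numeral)
  next
    case 1
    have "Suc 0 + 3 = 4" "Suc 0 + 2 = (3 :: nat)" "2 * Suc 0 + 4 = (6 :: nat)" by simp_all
    moreover have le3: "card (pairs_le 3) = card (pairs_le 2) + pair_count 3"
      using card_pairs_le_Suc[of 2] by simp
    have "F2 4 + 6 = of_nat (card (pairs_le 3) + card (pairs_parity 1))"
    proof -
      have "F2 2 = of_nat (pair_count 1) + of_nat (pair_count 0) - 2"
        using F2_rec[of 0] F2_rec[of 2] by simp
      moreover have "F2 4 = F2 2 + of_nat (pair_count 3) + of_nat (pair_count 2) + of_nat (pair_count 1) - 4"
        using F2_rec[of 4] by (simp add: algebra_simps)
      ultimately show ?thesis using le3 card_pairs_initial(3) by (simp add: le2)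
    qed
    ultimately show ?case by (simp only: of_nat_numeral One_nat_def)
  }
next
  case (ge2 n)
  have r: "F2 (Suc (Suc n) + 3) - F2 (n + 3) = of_nat (pair_count (n + 4)) + of_nat (pair_count (n + 3))
      + of_nat (pair_count (n + 2)) - 4"
    using F2_rec[of "Suc (Suc n) + 3"] by (simp add: add.commute)
  have "card (pairs_le (Suc (Suc n) + 2)) = card (pairs_le (n + 2)) + pair_count (n + 3) + pair_count (n + 4)"
    using card_pairs_le_Suc[of "n + 2"] card_pairs_le_Suc[of "n + 3"] by (simp add: numeral_eq_Suc)
  moreover have "F2 (n + 3) = of_nat (card (pairs_le (n + 2)) + card (pairs_parity n)) - of_nat (2 * n + 4)"
    using ge2(1) by (simp add: eq_diff_eq)
  with r have "F2 (Suc (Suc n) + 3) = of_nat (card (pairs_le (n + 2)) + card (pairs_parity n))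
      - of_nat (2 * n + 4) + (of_nat (pair_count (n + 4)) + of_nat (pair_count (n + 3))
      + of_nat (pair_count (n + 2)) - 4)" by (simp add: algebra_simps)
  ultimately show ?case using card_pairs_parity_Suc_Suc[of n] by simp
qed

lemma nonneg_Reals_of_nat_diff:
  assumes "z + of_nat a = (of_nat b :: complex)" "a \<le> b"
  shows "z \<in> \<real>\<^sub>\<ge>\<^sub>0"
proof -
  have "z = of_nat (b - a)" using assms by (simp add: of_nat_diff eq_diff_eq)
  then show ?thesis by simp
qed

lemma F2_initial_nonneg:
  assumes "n < 3"
  shows "F2 n \<in> \<real>\<^sub>\<ge>\<^sub>0"
proof -
  have "card {(0 :: nat, 0 :: nat)} \<le> pair_count 0"
    unfolding pair_count_def by (intro card_mono finite_pair_count) auto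
  then have p0: "1 \<le> pair_count 0" by simp
  have "card {(0 :: nat, 1 :: nat), (1, 0)} \<le> pair_count 1"
    unfolding pair_count_def by (intro card_mono finite_pair_count) auto
  then have p1: "2 \<le> pair_count 1" by simp
  have "F2 0 = 0" using F2_rec[of 0] by simp
  moreover have "F2 1 + of_nat 1 = of_nat (pair_count 0)" using F2_rec[of 1] by simp
  then have "F2 1 \<in> \<real>\<^sub>\<ge>\<^sub>0" using p0 by (rule nonneg_Reals_of_nat_diff)
  moreover have "F2 2 + of_nat 2 = of_nat (pair_count 1 + pair_count 0)"
    using F2_rec[of 2] \<open>F2 0 = 0\<close> by simp
  then have "F2 2 \<in> \<real>\<^sub>\<ge>\<^sub>0" by (rule nonneg_Reals_of_nat_diff) (use p1 in simp)
  moreover have "n \<in> {0, 1, 2}" using assms by auto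
  ultimately show ?thesis by auto
qed

section \<open>Lattice point bound for large radius\<close>

definition row_count :: "nat \<Rightarrow> nat \<Rightarrow> nat" where
  "row_count m x = card {b. x + triangle b \<le> m}"

lemma finite_row: "finite {b. x + triangle b \<le> m}"
proof (rule finite_subset)
  show "{b. x + triangle b \<le> m} \<subseteq> {..m}"
  proof
    fix b assume "b \<in> {b. x + triangle b \<le> m}"
    with le_triangle[of b] show "b \<in> {..m}" by simp
  qed
qed simp

lemma sum_row_count_le_pairs: "(\<Sum>a<A. row_count m (triangle a)) \<le> card (pairs_le m)"
proof -
  have "(\<Sum>a<A. row_count m (triangle a)) = card (SIGMA a:{..<A}. {b. triangle a + triangle b \<le> m})"
    unfolding row_count_def by (subst card_SigmaI) (auto simp: finite_row)
  also have "\<dots> \<le> card (pairs_le m)"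
    by (intro card_mono finite_pairs_le) (auto simp: pairs_le_def)
  finally show ?thesis .
qed

text \<open>
  The numbers \<open>T\<^bsub>2i\<^esub>\<close> and \<open>T\<^bsub>2i+1\<^esub>\<close> have opposite parity, because they differ by \<open>2i + 1\<close>. So for
  every \<open>b\<close> exactly one of the pairs \<open>(2i, b)\<close> and \<open>(2i + 1, b)\<close> has the required parity, and
  \<open>T\<^bsub>2i+1\<^esub> + T\<^sub>b \<le> m\<close> guarantees that it also satisfies the size condition.
\<close>

lemma sum_row_count_le_pairs_parity:
  "(\<Sum>i<I. row_count m (triangle (2 * i + 1))) \<le> card (pairs_parity m)"
proof -
  define S where "S = (SIGMA i:{..<I}. {b. triangle (2 * i + 1) + triangle b \<le> m})"
  define f where "f = (\<lambda>(i, b). (if even (triangle (2 * i) + triangle b + m) then 2 * i else 2 * i + 1, b :: nat))"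
  have "(\<Sum>i<I. row_count m (triangle (2 * i + 1))) = card S"
    unfolding row_count_def S_def by (subst card_SigmaI) (auto simp: finite_row simp del: triangle_Suc)
  also have "\<dots> \<le> card (pairs_parity m)"
  proof (rule card_inj_on_le[OF _ _ finite_pairs_parity])
    \<comment> \<open>Either choice of the first component has the half \<open>i\<close>, so \<open>f\<close> can be undone.\<close>
    have "(fst (f z) div 2, snd (f z)) = z" for z by (cases z) (simp add: f_def)
    then show "inj_on f S" by (rule inj_on_inverseI[of S "\<lambda>y. (fst y div 2, snd y)"])
    show "f ` S \<subseteq> pairs_parity m"
      unfolding f_def S_def pairs_parity_def by (auto split: if_splits)
  qed
  finally show ?thesis .
qed

lemma double_triangle_real: "2 * real (triangle n) = real n * (real n + 1)"
proof -
  have "real (2 * triangle n) = real (n * (n + 1))" by (simp only: double_triangle)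
  then show ?thesis by (simp add: algebra_simps)
qed

text \<open>
  For \<open>Y \<ge> 0\<close> this says \<open>Y (3K\<^sup>2 - Y) / (2K\<^sup>3) \<le> \<surd>Y\<close>, a lower bound of the square root by a
  polynomial that touches it at \<open>Y = K\<^sup>2\<close>; with \<open>s = \<surd>Y\<close> it is \<open>(K - s)\<^sup>2 (2K + s) \<ge> 0\<close>. For \<open>Y < 0\<close> the
  left-hand side is negative, so that empty rows are covered as well.
\<close>

lemma cubic_le_of_square_ge:
  fixes K w Y :: real
  assumes "0 < K" "0 < w" "Y \<le> w\<^sup>2"
  shows "Y * (3 * K\<^sup>2 - Y) \<le> 2 * K ^ 3 * w"
proof (cases "Y \<le> 0")
  case True
  then have "Y * (3 * K\<^sup>2 - Y) \<le> 0" using zero_le_power2[of K] by (intro mult_nonpos_nonneg) linarith+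
  also have "0 \<le> 2 * K ^ 3 * w" using assms by simp
  finally show ?thesis .
next
  case False
  define s where "s = sqrt Y"
  have s: "s\<^sup>2 = Y" "0 \<le> s" using False by (auto simp: s_def)
  have "s \<le> w" unfolding s_def using assms by (simp add: real_le_lsqrt)
  have "0 \<le> s * ((K - s)\<^sup>2 * (2 * K + s))" using assms s by (intro mult_nonneg_nonneg) auto
  moreover have "s * ((K - s)\<^sup>2 * (2 * K + s)) = 2 * K ^ 3 * s - s\<^sup>2 * (3 * K\<^sup>2 - s\<^sup>2)"
    by algebra
  ultimately have "s\<^sup>2 * (3 * K\<^sup>2 - s\<^sup>2) \<le> 2 * K ^ 3 * s" by simp
  also have "\<dots> \<le> 2 * K ^ 3 * w" using \<open>s \<le> w\<close> assms by (intro mult_left_mono) auto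
  finally show ?thesis unfolding s(1) .
qed

text \<open>
  If \<open>g\<close> is the length of the row, then \<open>b = g\<close> is no longer in it, hence
  \<open>(g + 1/2)\<^sup>2 = 2 T\<^sub>g + 1/4 > 2 (m - x) + 1/4\<close>. The square root is replaced by its polynomial lower
  bound, so that the bounds for all rows can be summed in closed form.
\<close>

lemma row_count_lower:
  fixes K :: real and m x :: nat
  assumes K: "0 < K"
  defines "Y \<equiv> 2 * (real m - real x) + 1/4"
  shows "Y * (3 * K\<^sup>2 - Y) \<le> 2 * K ^ 3 * (real (row_count m x) + 1/2)"
proof (rule cubic_le_of_square_ge[OF K])
  define g where "g = row_count m x"
  have "x + triangle g > m"
  proof (rule ccontr)
    assume "\<not> x + triangle g > m"
    then have "{..g} \<subseteq> {b. x + triangle b \<le> m}"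
      by (force dest: strict_mono_leD[OF strict_mono_triangle])
    from card_mono[OF finite_row this] show False by (simp add: g_def row_count_def)
  qed
  then have "real m < real x + real (triangle g)" by linarith
  moreover have "2 * real (triangle g) = real g * (real g + 1)"
    by (rule double_triangle_real)
  ultimately show "Y \<le> (real (row_count m x) + 1/2)\<^sup>2"
    unfolding Y_def g_def[symmetric] by (simp add: power2_eq_square algebra_simps)
qed simp

lemma sum_half_odd_powers:
  "(\<Sum>a<m. (real a + 1/2)\<^sup>2) = (4 * real m ^ 3 - real m) / 12" (is ?A)
  "(\<Sum>a<m. (real a + 1/2) ^ 4) = (48 * real m ^ 5 - 40 * real m ^ 3 + 7 * real m) / 240" (is ?B)
proof -
  have 2: "12 * (x + 1/2)\<^sup>2 = (4 * (x + 1) ^ 3 - (x + 1)) - (4 * x ^ 3 - x)" for x :: real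
    by algebra
  have 4: "240 * (x + 1/2) ^ 4 = (48 * (x + 1) ^ 5 - 40 * (x + 1) ^ 3 + 7 * (x + 1))
      - (48 * x ^ 5 - 40 * x ^ 3 + 7 * x)" for x :: real
    by algebra
  show ?A
  proof (induction m)
    case (Suc m)
    then show ?case using 2[of "real m"] by (simp add: add.commute)
  qed simp
  show ?B
  proof (induction m)
    case (Suc m)
    then show ?case using 4[of "real m"] by (simp add: add.commute)
  qed simp
qed

lemma sum_half_odd_powers_step2:
  "(\<Sum>i<m. (2 * real i + 3/2)\<^sup>2) = (16 * real m ^ 3 + 12 * (real m)\<^sup>2 - real m) / 12" (is ?A)
  "(\<Sum>i<m. (2 * real i + 3/2) ^ 4)
     = (768 * real m ^ 5 + 960 * real m ^ 4 - 160 * real m ^ 3 - 360 * (real m)\<^sup>2 + 7 * real m) / 240" (is ?B)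
proof -
  have 2: "12 * (2 * x + 3/2)\<^sup>2 = (16 * (x + 1) ^ 3 + 12 * (x + 1)\<^sup>2 - (x + 1)) - (16 * x ^ 3 + 12 * x\<^sup>2 - x)"
    for x :: real by algebra
  have 4: "240 * (2 * x + 3/2) ^ 4
      = (768 * (x + 1) ^ 5 + 960 * (x + 1) ^ 4 - 160 * (x + 1) ^ 3 - 360 * (x + 1)\<^sup>2 + 7 * (x + 1))
      - (768 * x ^ 5 + 960 * x ^ 4 - 160 * x ^ 3 - 360 * x\<^sup>2 + 7 * x)" for x :: real
    by algebra
  show ?A
  proof (induction m)
    case (Suc m)
    then show ?case using 2[of "real m"] by (simp add: add.commute)
  qed simp
  show ?B
  proof (induction m)
    case (Suc m)
    then show ?case using 4[of "real m"] by (simp add: add.commute)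
  qed simp
qed

text \<open>
  The row bounds are summed over the rows \<open>a < 2I\<close> of the full count and over the rows \<open>2i + 1\<close> with
  \<open>i < I\<close> of the parity count. In the full count the row \<open>a\<close> contributes the polynomial at
  \<open>X - (a + 1/2)\<^sup>2\<close>, where \<open>X\<close> is the squared radius \<open>2(n + 2) + 1/2\<close>; for the parity count the
  squared radius is \<open>2n + 1/2 = X - 4\<close>. The scale \<open>K = 2I\<close> is the even integer nearest to \<open>\<surd>X\<close>, so
  that the polynomial is close to the square root on the whole range. With \<open>x = I\<close> and
  \<open>X = 4x\<^sup>2 + d\<close> the margin in the inequality, multiplied by \<open>2K\<^sup>3\<close>, is a polynomial with leading term
  \<open>32/5 x\<^sup>5\<close>, and \<open>\<bar>d\<bar> \<le> 4x + 1\<close> makes it nonnegative for \<open>x \<ge> 9\<close>. The condition on \<open>n\<close> is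
  \<open>X \<ge> 17\<^sup>2\<close>, which is where \<open>I \<ge> 9\<close> begins.
\<close>

lemma lattice_bound_large:
  assumes n: "143 \<le> n"
  shows "2 * n + 4 \<le> card (pairs_le (n + 2)) + card (pairs_parity n)"
proof -
  define X where "X = 2 * real n + 9/2"
  define I where "I = nat \<lfloor>(sqrt X + 1) / 2\<rfloor>"
  have X: "X > 289" using n by (simp add: X_def)
  have sX: "17 \<le> sqrt X" using X by (intro real_le_rsqrt) simp
  have fl: "real I \<le> (sqrt X + 1) / 2" "(sqrt X + 1) / 2 < real I + 1"
  proof -
    have "real I = of_int \<lfloor>(sqrt X + 1) / 2\<rfloor>" unfolding I_def using sX by (intro of_nat_nat) simp
    then show "real I \<le> (sqrt X + 1) / 2" "(sqrt X + 1) / 2 < real I + 1" by linarith+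
  qed
  have I: "9 \<le> I" using sX unfolding I_def by (simp add: le_nat_floor)
  have X1: "(2 * real I - 1)\<^sup>2 \<le> X"
  proof -
    have "(2 * real I - 1)\<^sup>2 \<le> (sqrt X)\<^sup>2" using fl I by (intro power_mono) auto
    then show ?thesis using X by simp
  qed
  have X2: "X \<le> (2 * real I + 1)\<^sup>2"
  proof -
    have "(sqrt X)\<^sup>2 \<le> (2 * real I + 1)\<^sup>2" using fl sX X by (intro power_mono) auto
    then show ?thesis using X by simp
  qed
  define K where "K = 2 * real I"
  have K: "0 < K" using I by (simp add: K_def)
  define p where "p Y = Y * (3 * K\<^sup>2 - Y)" for Y
  have r1: "p (X - (real a + 1/2)\<^sup>2) \<le> 2 * K ^ 3 * (real (row_count (n + 2) (triangle a)) + 1/2)" for a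
  proof -
    have "2 * real (triangle a) = real a * (real a + 1)"
      by (rule double_triangle_real)
    then have "2 * (real (n + 2) - real (triangle a)) + 1/4 = X - (real a + 1/2)\<^sup>2"
      by (simp add: X_def power2_eq_square algebra_simps)
    with row_count_lower[OF K, of "n + 2" "triangle a"] show ?thesis by (simp add: p_def)
  qed
  have r2: "p (X - 4 - (2 * real i + 3/2)\<^sup>2) \<le> 2 * K ^ 3 * (real (row_count n (triangle (2 * i + 1))) + 1/2)" for i
  proof -
    have "2 * real (triangle (2 * i + 1)) = real (2 * i + 1) * (real (2 * i + 1) + 1)"
      by (rule double_triangle_real)
    then have "2 * (real n - real (triangle (2 * i + 1))) + 1/4 = X - 4 - (2 * real i + 3/2)\<^sup>2"
      by (simp add: X_def power2_eq_square algebra_simps del: triangle_Suc)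
    with row_count_lower[OF K, of n "triangle (2 * i + 1)"] show ?thesis by (simp add: p_def del: triangle_Suc)
  qed
  have p_expand: "p (Z - u\<^sup>2) = Z * (3 * K\<^sup>2 - Z) + (2 * Z - 3 * K\<^sup>2) * u\<^sup>2 - u ^ 4" for Z u
    by (simp add: p_def algebra_simps eval_nat_numeral)
  have "(\<Sum>a<2 * I. p (X - (real a + 1/2)\<^sup>2)) \<le> (\<Sum>a<2 * I. 2 * K ^ 3 * (real (row_count (n + 2) (triangle a)) + 1/2))"
    by (intro sum_mono r1)
  also have "\<dots> = 2 * K ^ 3 * (real (\<Sum>a<2 * I. row_count (n + 2) (triangle a)) + real I)"
    by (simp add: sum_distrib_left[symmetric] sum.distrib)
  also have "\<dots> \<le> 2 * K ^ 3 * (real (card (pairs_le (n + 2))) + real I)"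
    using K sum_row_count_le_pairs[of "n + 2" "2 * I"] by (intro mult_left_mono add_right_mono) (auto simp flip: of_nat_sum)
  finally have b1: "(\<Sum>a<2 * I. p (X - (real a + 1/2)\<^sup>2)) \<le> 2 * K ^ 3 * (real (card (pairs_le (n + 2))) + real I)" .
  have "(\<Sum>i<I. p (X - 4 - (2 * real i + 3/2)\<^sup>2)) \<le> (\<Sum>i<I. 2 * K ^ 3 * (real (row_count n (triangle (2 * i + 1))) + 1/2))"
    by (intro sum_mono r2)
  also have "\<dots> = 2 * K ^ 3 * (real (\<Sum>i<I. row_count n (triangle (2 * i + 1))) + real I / 2)"
    by (simp add: sum_distrib_left[symmetric] sum.distrib del: triangle_Suc)
  also have "\<dots> \<le> 2 * K ^ 3 * (real (card (pairs_parity n)) + real I / 2)"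
    using K sum_row_count_le_pairs_parity[of n I]
    by (intro mult_left_mono add_right_mono) (auto simp del: triangle_Suc simp flip: of_nat_sum)
  finally have b2: "(\<Sum>i<I. p (X - 4 - (2 * real i + 3/2)\<^sup>2)) \<le> 2 * K ^ 3 * (real (card (pairs_parity n)) + real I / 2)" .
  define x d where "x = real I" and "d = X - 4 * x\<^sup>2"
  have Xd: "X = 4 * x\<^sup>2 + d" by (simp add: d_def)
  have dd: "\<bar>d\<bar> \<le> 4 * x + 1" using X1 X2 I unfolding x_def[symmetric] d_def
    by (simp add: power2_eq_square algebra_simps abs_le_iff)
  have s1: "(\<Sum>a<2 * I. p (X - (real a + 1/2)\<^sup>2))
      = 2 * x * (X * (12 * x\<^sup>2 - X)) + (2 * X - 12 * x\<^sup>2) * ((16 * x ^ 3 - x) / 6)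
        - (768 * x ^ 5 - 160 * x ^ 3 + 7 * x) / 120"
    unfolding p_expand sum_subtractf sum.distrib sum_distrib_left[symmetric] sum_half_odd_powers
    unfolding K_def x_def sum_constant card_lessThan of_nat_mult of_nat_numeral by algebra
  have s2: "(\<Sum>i<I. p (X - 4 - (2 * real i + 3/2)\<^sup>2))
      = x * ((X - 4) * (12 * x\<^sup>2 - (X - 4))) + (2 * (X - 4) - 12 * x\<^sup>2) * ((16 * x ^ 3 + 12 * x\<^sup>2 - x) / 12)
        - (768 * x ^ 5 + 960 * x ^ 4 - 160 * x ^ 3 - 360 * x ^ 2 + 7 * x) / 240"
    unfolding p_expand sum_subtractf sum.distrib sum_distrib_left[symmetric] sum_half_odd_powers_step2
    unfolding K_def x_def sum_constant card_lessThan of_nat_mult of_nat_numeral by algebra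
  \<comment> \<open>The summand \<open>3/2 x\<close> collects the deficits 1/2 of the \<open>3I\<close> rows, and \<open>X - 1/2 = 2n + 4\<close>.\<close>
  have total: "(\<Sum>a<2 * I. p (X - (real a + 1/2)\<^sup>2)) + (\<Sum>i<I. p (X - 4 - (2 * real i + 3/2)\<^sup>2))
      - 2 * K ^ 3 * (3/2 * x + X - 1/2)
    = 32/5 * x ^ 5 - 32 * x ^ 4 - 47/3 * x ^ 3 - 13/2 * x\<^sup>2 - 3701/240 * x
        + d * (4 * x ^ 3 + 2 * x\<^sup>2 + 15/2 * x) - 3 * d\<^sup>2 * x" (is "_ = ?Q")
    unfolding s1 s2 unfolding Xd K_def x_def[symmetric] by algebra
  have "0 \<le> ?Q"
  proof -
    have x9: "9 \<le> x" using I by (simp add: x_def)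
    then have pw: "9 * x ^ k \<le> x ^ Suc k" for k by (simp add: mult_right_mono)
    define c where "c = 4 * x ^ 3 + 2 * x\<^sup>2 + 15/2 * x"
    have "0 \<le> c" using x9 by (simp add: c_def)
    have "\<bar>d * c\<bar> \<le> (4 * x + 1) * c"
      unfolding abs_mult using dd \<open>0 \<le> c\<close> by (intro mult_mono) auto
    moreover have "(4 * x + 1) * c = 16 * x ^ 4 + 12 * x ^ 3 + 32 * x\<^sup>2 + 15/2 * x"
      unfolding c_def by algebra
    moreover have "d\<^sup>2 * x \<le> (4 * x + 1)\<^sup>2 * x"
      using dd x9 by (intro mult_right_mono) (auto simp: abs_le_square_iff[symmetric])
    moreover have "(4 * x + 1)\<^sup>2 * x = 16 * x ^ 3 + 8 * x\<^sup>2 + x" by algebra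
    moreover have "9 * x ^ 4 \<le> x ^ 5" "9 * x ^ 3 \<le> x ^ 4" "9 * x\<^sup>2 \<le> x ^ 3" "9 * x \<le> x\<^sup>2"
      using pw[of 4] pw[of 3] pw[of 2] pw[of 1] by (simp_all add: eval_nat_numeral)
    ultimately show ?thesis unfolding c_def[symmetric] using x9 by linarith
  qed
  with b1 b2 total have "2 * K ^ 3 * (3/2 * x + X - 1/2)
     \<le> 2 * K ^ 3 * (real (card (pairs_le (n + 2))) + real I) + 2 * K ^ 3 * (real (card (pairs_parity n)) + real I / 2)"
    by linarith
  also have "\<dots> = 2 * K ^ 3 * (real (card (pairs_le (n + 2))) + real (card (pairs_parity n)) + 3/2 * x)"
    by (simp add: x_def algebra_simps)
  finally have "3/2 * x + X - 1/2 \<le> real (card (pairs_le (n + 2))) + real (card (pairs_parity n)) + 3/2 * x"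
    using K by (subst (asm) mult_le_cancel_left_pos) auto
  then have "real (2 * n + 4) \<le> real (card (pairs_le (n + 2)) + card (pairs_parity n))"
    by (simp add: X_def)
  then show ?thesis by (simp only: of_nat_le_iff)
qed

section \<open>Lattice point bound for small radius\<close>

text \<open>
  The first 17 triangular numbers, as integers in binary so that the counts can be evaluated by
  rewriting. Pairs with larger entries only increase the counts, so the list yields lower bounds for
  every \<open>n\<close>.
\<close>

definition small_triangles :: "int list" where
  "small_triangles = [0, 1, 3, 6, 10, 15, 21, 28, 36, 45, 55, 66, 78, 91, 105, 120, 136]"

definition small_sums :: "int list" where
  "small_sums = [x + y. x \<leftarrow> small_triangles, y \<leftarrow> small_triangles]"

definition small_count :: "int \<Rightarrow> nat" where
  "small_count n = length (filter (\<lambda>s. s \<le> n + 2) small_sums)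
     + length (filter (\<lambda>s. s \<le> n \<and> even (s + n)) small_sums)"

lemma length_filter_small_sums_le:
  assumes "finite S" and "\<And>a b. Q (int (triangle a + triangle b)) \<Longrightarrow> (a, b) \<in> S"
  shows "length (filter Q small_sums) \<le> card S"
proof -
  let ?ps = "List.product [0..<17] [0..<17]"
  have st: "small_triangles = map (\<lambda>a. int (triangle a)) [0..<17]"
    by (simp add: small_triangles_def triangle_def upt_rec del: upt.simps)
  have ss: "small_sums = map (\<lambda>(a, b). int (triangle a + triangle b)) ?ps"
    unfolding small_sums_def st by (simp add: product_concat_map map_concat comp_def)
  have "length (filter Q small_sums) = length (filter (Q \<circ> (\<lambda>(a, b). int (triangle a + triangle b))) ?ps)"
    unfolding ss by (simp only: filter_map length_map)
  also have "\<dots> = card (set (filter (Q \<circ> (\<lambda>(a, b). int (triangle a + triangle b))) ?ps))"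
    by (intro distinct_card[symmetric] distinct_filter distinct_product) auto
  also have "\<dots> \<le> card S" by (intro card_mono assms(1)) (auto intro: assms(2))
  finally show ?thesis .
qed

lemma small_count_le:
  "small_count (int n) \<le> card (pairs_le (n + 2)) + card (pairs_parity n)"
  unfolding small_count_def
proof (intro add_mono length_filter_small_sums_le finite_pairs_le finite_pairs_parity)
  fix a b
  show "(a, b) \<in> pairs_le (n + 2)" if "int (triangle a + triangle b) \<le> int n + 2"
    using that by (simp add: pairs_le_def)
  show "(a, b) \<in> pairs_parity n"
    if "int (triangle a + triangle b) \<le> int n \<and> even (int (triangle a + triangle b) + int n)"
  proof -
    have "even (int (triangle a + triangle b + n))" using that by simp
    then have "even (triangle a + triangle b + n)" by (simp only: even_of_nat)
    then show ?thesis using that by (simp add: pairs_parity_def pairs_le_def)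
  qed
qed

lemma pairs_mono:
  assumes "m \<le> n" "even (m + n)"
  shows "card (pairs_le (m + 2)) + card (pairs_parity m) \<le> card (pairs_le (n + 2)) + card (pairs_parity n)"
proof (intro add_mono card_mono finite_pairs_le finite_pairs_parity)
  show "pairs_le (m + 2) \<subseteq> pairs_le (n + 2)" "pairs_parity m \<subseteq> pairs_parity n"
    using assms by (auto simp: pairs_parity_def pairs_le_def)
qed

text \<open>
  An entry \<open>(m, n)\<close> records that the count at \<open>m\<close> is at least \<open>2n + 4\<close>. As the count increases along
  each residue class modulo 2, this settles all numbers from \<open>m\<close> to \<open>n\<close> of the parity of \<open>m\<close>. The
  intervals were chosen greedily, each as long as the count at its left end permits.
\<close>

definition checkpoints :: "(int \<times> int) list" where
  "checkpoints =
    [(0, 0), (2, 2), (4, 4), (6, 8), (10, 12), (14, 16), (18, 20), (22, 26), (28, 32), (34, 40),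
     (42, 50), (52, 60), (62, 72), (74, 88), (90, 106), (108, 128), (130, 152),
     (1, 1), (3, 3), (5, 5), (7, 7), (9, 11), (13, 15), (17, 19), (21, 25), (27, 31), (33, 39),
     (41, 47), (49, 57), (59, 71), (73, 85), (87, 101), (103, 121), (123, 145)]"

lemma checkpoints_hold: "list_all (\<lambda>(m, n). 0 \<le> m \<and> 2 * n + 4 \<le> int (small_count m)) checkpoints"
  by code_simp

lemma checkpoints_cover:
  "list_all (\<lambda>n. list_ex (\<lambda>(m, n'). m \<le> n \<and> n \<le> n' \<and> even (m + n)) checkpoints) [0..142]"
  by code_simp

lemma lattice_bound_small:
  assumes "n \<le> 142"
  shows "2 * n + 4 \<le> card (pairs_le (n + 2)) + card (pairs_parity n)"
proof -
  from assms have "int n \<in> set [0..142]" by simp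
  with checkpoints_cover obtain m n' where m: "(m, n') \<in> set checkpoints" "m \<le> int n" "int n \<le> n'" "even (m + int n)"
    unfolding list_all_iff list_ex_iff by blast
  with checkpoints_hold have c: "0 \<le> m" "2 * n' + 4 \<le> int (small_count m)"
    unfolding list_all_iff by auto
  define k where "k = nat m"
  have k: "m = int k" using c by (simp add: k_def)
  have "even (int (k + n))" using m(4) k by simp
  then have "even (k + n)" by (simp only: even_of_nat)
  with m(2) k have "card (pairs_le (k + 2)) + card (pairs_parity k) \<le> card (pairs_le (n + 2)) + card (pairs_parity n)"
    by (intro pairs_mono) auto
  with small_count_le[of k] c(2)[unfolded k] m(3) show ?thesis by linarith
qed

section \<open>Nonnegativity of the coefficients\<close>

theorem corollary2p6:
  shows "\<forall>n. F2 n \<in> \<real>\<^sub>\<ge>\<^sub>0"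
proof
  fix n
  show "F2 n \<in> \<real>\<^sub>\<ge>\<^sub>0"
  proof (cases "n < 3")
    case True
    then show ?thesis by (rule F2_initial_nonneg)
  next
    case False
    define m where "m = n - 3"
    have n: "n = m + 3" using False by (simp add: m_def)
    have "2 * m + 4 \<le> card (pairs_le (m + 2)) + card (pairs_parity m)"
      using lattice_bound_small[of m] lattice_bound_large[of m] by (cases "m \<le> 142") auto
    with F2_eq_lattice_count[of m] show ?thesis unfolding n by (rule nonneg_Reals_of_nat_diff)
  qed
qed

end
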